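(* Let $n\ge 1$, let $A=(a_{ij})\in M_n(\mathbb{Z})$ be a skew-symmetric matrix, and let $R=\mathbb{C}[X_1,\ldots,X_n]$ be the Poisson algebra with $\{X_i,X_j\}=a_{ij}X_iX_j$. Set $$C=\Big\{\gamma\in\mathbb{N}^n\ \Big|\ \text{for all } 1\le i\le n,\ \gamma_i=0\ \text{ or }\ \sum_{j=1}^n a_{ij}(\gamma_j-1)=0\Big\}.$$ Then for every $k\in\mathbb{N}$ the Poisson cohomology of $R$ satisfies, as a vector space, $$HP^k(R)\simeq\bigoplus_{\substack{\alpha\in\mathbb{N}^n,\ \beta\in\{0,1\}^n\\ |\beta|=n-k,\ \alpha+\beta\in C}}\mathbb{C}\,X^\alpha dX^\beta .$$
   Context: Notation: $\mathbb{N}$ contains $0$; $X^\alpha=X_1^{\alpha_1}\cdots X_n^{\alpha_n}$; for $\beta\in\{0,1\}^n$, $|\beta|=\sum_i\beta_i$ and $dX^\beta=dX_{i_1}\wedge\cdots\wedge dX_{i_r}$, where $i_1<\cdots<i_r$ are the indices $i$ with $\beta_i=1$, so that the elements $X^\alpha dX^\beta$ are linearly independent differential forms on $R$ (Kähler differentials over $\mathbb{C}$). A Poisson algebra is a commutative $\mathbb{C}$-algebra $R$ with a Lie bracket $\{\cdot,\cdot\}$ such that each $\{r,\cdot\}$ is a $\mathbb{C}$-linear derivation of $R$. Poisson cohomology: $HP^*(R)$ is the cohomology of the complex $\chi^k(R)$ of skew-symmetric $k$-linear (over $\mathbb{C}$) maps $R^k\to R$ that are derivations in each argument, with coboundary $\delta_k:\chi^k(R)\to\chi^{k+1}(R)$,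 $$\delta_k(P)(f_0,\ldots,f_k)=\sum_{i=0}^k(-1)^i\{f_i,P(f_0,\ldots,\widehat{f_i},\ldots,f_k)\}+\sum_{0\le i<j\le k}(-1)^{i+j}P(\{f_i,f_j\},f_0,\ldots,\widehat{f_i},\ldots,\widehat{f_j},\ldots,f_k),$$ hats denoting omitted terms. *)

theory Defs
  imports
    "HOL-Analysis.Finite_Cartesian_Product"
    "HOL-Library.Poly_Mapping"
    "HOL-Library.Function_Algebras"
    "HOL-Library.Set_Algebras"
begin

section \<open>Quotients of vector spaces\<close>

text \<open>
  The elements of the quotient by a subspace \<open>U\<close> are the cosets \<open>w +o U\<close>.
  When \<open>W\<close> is a subspace not containing \<open>U\<close>, \<open>quotient_space W U\<close> is the image
  of \<open>W\<close> in the quotient by \<open>U\<close>, that is \<open>(W + U) / U\<close>.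
\<close>

definition quotient_space :: "'v::ab_group_add set \<Rightarrow> 'v set \<Rightarrow> 'v set set" where
  "quotient_space W U = (\<lambda>w. w +o U) ` W"

text \<open>
  On cosets of \<open>U\<close>, addition is the elementwise sum of sets. In the scalar
  multiplication the summand \<open>U\<close> only matters for the scalar 0, which has to
  produce the coset \<open>U\<close> and not \<open>{0}\<close>.
\<close>

definition quotient_scale ::
    "('k \<Rightarrow> 'v \<Rightarrow> 'v) \<Rightarrow> 'v::ab_group_add set \<Rightarrow> 'k \<Rightarrow> 'v set \<Rightarrow> 'v set" where
  "quotient_scale s U c A = s c ` A + U"

definition quotient_isomorphic ::
    "('k \<Rightarrow> 'v \<Rightarrow> 'v) \<Rightarrow> 'v::ab_group_add set \<Rightarrow> 'v set \<Rightarrow>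
     ('k \<Rightarrow> 'w \<Rightarrow> 'w) \<Rightarrow> 'w::ab_group_add set \<Rightarrow> 'w set \<Rightarrow> bool" where
  "quotient_isomorphic s W U s' W' U' \<longleftrightarrow>
     (\<exists>\<phi>. bij_betw \<phi> (quotient_space W U) (quotient_space W' U') \<and>
          (\<forall>A\<in>quotient_space W U. \<forall>B\<in>quotient_space W U. \<phi> (A + B) = \<phi> A + \<phi> B) \<and>
          (\<forall>c. \<forall>A\<in>quotient_space W U.
             \<phi> (quotient_scale s U c A) = quotient_scale s' U' c (\<phi> A)))"

section \<open>Poisson algebras and Poisson cohomology\<close>

text \<open>
  A commutative complex algebra is a commutative ring \<open>'r\<close> with a scalar
  multiplication \<open>sc\<close> by complex numbers.
\<close>

locale complex_algebra = vector_space sc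
  for sc :: "complex \<Rightarrow> 'r::comm_ring_1 \<Rightarrow> 'r" +
  assumes scale_mult_left: "sc c (f * g) = sc c f * g"

definition derivation :: "(complex \<Rightarrow> 'r \<Rightarrow> 'r) \<Rightarrow> ('r::comm_ring_1 \<Rightarrow> 'r) \<Rightarrow> bool" where
  "derivation sc D \<longleftrightarrow>
     Vector_Spaces.linear sc sc D \<and> (\<forall>f g. D (f * g) = f * D g + g * D f)"

locale poisson_algebra = complex_algebra sc
  for sc :: "complex \<Rightarrow> 'r::comm_ring_1 \<Rightarrow> 'r" +
  fixes br :: "'r \<Rightarrow> 'r \<Rightarrow> 'r"
  assumes linear_left: "Vector_Spaces.linear sc sc (\<lambda>f. br f g)"
    and derivation_right: "derivation sc (br f)"
    and alternating: "br f f = 0"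
    and jacobi: "br f (br g h) + br g (br h f) + br h (br f g) = 0"

text \<open>
  A \<open>k\<close>-ary map is represented as a function on lists that vanishes on lists of
  length different from \<open>k\<close>.
\<close>

definition cochains :: "(complex \<Rightarrow> 'r \<Rightarrow> 'r) \<Rightarrow> nat \<Rightarrow> ('r::comm_ring_1 list \<Rightarrow> 'r) set" where
  "cochains sc k =
     {P. (\<forall>fs. length fs \<noteq> k \<longrightarrow> P fs = 0) \<and>
         (\<forall>fs i. length fs = k \<and> i < k \<longrightarrow> derivation sc (\<lambda>g. P (fs[i := g]))) \<and>
         (\<forall>fs i j. length fs = k \<and> i < j \<and> j < k \<longrightarrow> P (fs[i := fs ! j, j := fs ! i]) = - P fs)}"

text \<open>\<open>nths fs (- I)\<close> is the list \<open>fs\<close> without the entries at the positions in \<open>I\<close>.\<close>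

definition coboundary ::
    "('r \<Rightarrow> 'r \<Rightarrow> 'r) \<Rightarrow> nat \<Rightarrow> ('r::comm_ring_1 list \<Rightarrow> 'r) \<Rightarrow> 'r list \<Rightarrow> 'r" where
  "coboundary br k P fs =
     (if length fs = Suc k then
        (\<Sum>i\<le>k. (-1) ^ i * br (fs ! i) (P (nths fs (- {i})))) +
        (\<Sum>j\<le>k. \<Sum>i<j. (-1) ^ (i + j) * P (br (fs ! i) (fs ! j) # nths fs (- {i, j})))
      else 0)"

definition cocycles ::
    "(complex \<Rightarrow> 'r \<Rightarrow> 'r) \<Rightarrow> ('r \<Rightarrow> 'r \<Rightarrow> 'r) \<Rightarrow> nat \<Rightarrow> ('r::comm_ring_1 list \<Rightarrow> 'r) set" where
  "cocycles sc br k = {P \<in> cochains sc k. coboundary br k P = 0}"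

fun coboundaries ::
    "(complex \<Rightarrow> 'r \<Rightarrow> 'r) \<Rightarrow> ('r \<Rightarrow> 'r \<Rightarrow> 'r) \<Rightarrow> nat \<Rightarrow> ('r::comm_ring_1 list \<Rightarrow> 'r) set" where
  "coboundaries sc br 0 = {0}"
| "coboundaries sc br (Suc k) = coboundary br k ` cochains sc k"

definition cochain_scale ::
    "(complex \<Rightarrow> 'r \<Rightarrow> 'r) \<Rightarrow> complex \<Rightarrow> ('r list \<Rightarrow> 'r) \<Rightarrow> 'r list \<Rightarrow> 'r" where
  "cochain_scale sc c P = (\<lambda>fs. sc c (P fs))"

section \<open>Differential forms\<close>

text \<open>
  The exterior algebra of the module of Kaehler differentials of \<open>'r\<close> over the
  complex numbers is presented as the quotient of the free \<open>'r\<close>-module on lists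
  over \<open>'r\<close> by \<open>form_relations sc\<close>. The class of \<open>form g [f\<^sub>1, \<dots>, f\<^sub>r]\<close> is
  the form \<open>g df\<^sub>1 \<and> \<dots> \<and> df\<^sub>r\<close>.
\<close>

type_synonym 'r free_form = "'r list \<Rightarrow>\<^sub>0 'r"

definition form :: "'r::comm_ring_1 \<Rightarrow> 'r list \<Rightarrow> 'r free_form" where
  "form g fs = Poly_Mapping.single fs g"

inductive_set form_generators ::
    "(complex \<Rightarrow> 'r \<Rightarrow> 'r) \<Rightarrow> 'r::comm_ring_1 free_form set"
  for sc :: "complex \<Rightarrow> 'r \<Rightarrow> 'r" where
  add: "form 1 (us @ (f + g) # vs) - form 1 (us @ f # vs) - form 1 (us @ g # vs)
          \<in> form_generators sc"
| scale: "form 1 (us @ sc c f # vs) - form (sc c 1) (us @ f # vs) \<in> form_generators sc"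
| leibniz: "form 1 (us @ (f * g) # vs) - form f (us @ g # vs) - form g (us @ f # vs)
          \<in> form_generators sc"
| alternating: "\<not> distinct fs \<Longrightarrow> form 1 fs \<in> form_generators sc"

definition form_relations ::
    "(complex \<Rightarrow> 'r \<Rightarrow> 'r) \<Rightarrow> 'r::comm_ring_1 free_form set" where
  "form_relations sc = module.span (\<lambda>r. Poly_Mapping.map ((*) r)) (form_generators sc)"

definition form_scale ::
    "(complex \<Rightarrow> 'r \<Rightarrow> 'r) \<Rightarrow> complex \<Rightarrow> 'r::comm_ring_1 free_form \<Rightarrow> 'r free_form" where
  "form_scale sc c = Poly_Mapping.map (sc c)"

section \<open>Polynomials\<close>

text \<open>
  Polynomials in variables indexed by the finite type \<open>'n\<close>; a multi-index is an
  element of \<open>'n \<Rightarrow>\<^sub>0 nat\<close>.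
\<close>

type_synonym 'n cpoly = "('n \<Rightarrow>\<^sub>0 nat) \<Rightarrow>\<^sub>0 complex"

definition pscale :: "complex \<Rightarrow> 'n cpoly \<Rightarrow> 'n cpoly" where
  "pscale c = Poly_Mapping.map ((*) c)"

definition X_pow :: "('n \<Rightarrow>\<^sub>0 nat) \<Rightarrow> 'n cpoly" where
  "X_pow \<alpha> = Poly_Mapping.single \<alpha> 1"

definition X :: "'n \<Rightarrow> 'n cpoly" where
  "X i = X_pow (Poly_Mapping.single i 1)"

definition monomial_form ::
    "('n::{finite,linorder} \<Rightarrow>\<^sub>0 nat) \<Rightarrow> ('n \<Rightarrow>\<^sub>0 nat) \<Rightarrow> 'n cpoly free_form" where
  "monomial_form \<alpha> \<beta> =
     form (X_pow \<alpha>) (map X (sorted_list_of_set {i. Poly_Mapping.lookup \<beta> i = 1}))"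

definition index_set_C :: "int ^ 'n ^ 'n::finite \<Rightarrow> ('n \<Rightarrow>\<^sub>0 nat) set" where
  "index_set_C A =
     {\<gamma>. \<forall>i. Poly_Mapping.lookup \<gamma> i = 0 \<or>
             (\<Sum>j\<in>UNIV. A $ i $ j * (int (Poly_Mapping.lookup \<gamma> j) - 1)) = 0}"

text \<open>
  The condition on the size of \<open>\<beta>\<close> is written with a sum because subtraction
  on \<open>nat\<close> truncates: for \<open>k\<close> larger than the number of variables there is no
  such \<open>\<beta>\<close>. As the monomial forms are linearly independent modulo
  \<open>form_relations pscale\<close>, their span is the direct sum of the lines they generate.
\<close>

definition form_basis ::
    "int ^ 'n::{finite,linorder} ^ 'n::{finite,linorder} \<Rightarrow> nat \<Rightarrow> 'n cpoly free_form set" where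
  "form_basis A k =
     {monomial_form \<alpha> \<beta> | \<alpha> \<beta>.
        (\<forall>i. Poly_Mapping.lookup \<beta> i \<in> {0, 1}) \<and>
        (\<Sum>i\<in>UNIV. Poly_Mapping.lookup \<beta> i) + k = CARD('n) \<and>
        \<alpha> + \<beta> \<in> index_set_C A}"

end

(* A skew-symmetric multiderivation of R is determined by its values on tuples of variables.
   Give the term X^alpha d/dX_I of such a multiderivation the weight w = alpha - 1_I. Since the
   bracket is log-canonical, the coboundary preserves weights, and on the part of weight w it is the
   exterior product with the vector of the residues u_i = sum_j a_ij w_j, taken in the exterior
   algebra on the log-derivations X_i d/dX_i. If u_i is nonzero for some i with w_i >= 0, then
   contraction with the i-th coordinate divided by u_i is a contracting homotopy; otherwise the
   differential vanishes. The weights of the second kind are those with w + 1 in C, and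
   X^alpha d/dX_I corresponds to X^alpha dX^beta, where beta is the indicator of the complement
   of I. *)

theory Submission
  imports "HOL-Combinatorics.Permutations" Defs
begin

section \<open>Quotients and lists with an entry removed\<close>

text \<open>The terms X^alpha d/dX_I of weight w are those with I containing N = {i. w_i < 0}, and
  they exist only if all w_i >= -1. So the part of weight w is an exterior algebra on the
  coordinates outside N, multiplied by the top vector on N. Exterior multiplication by u does not
  see the u_i with i in N; hence only indices with w_i >= 0 decide whether the differential
  vanishes, and contraction with such an index stays inside the part. Three obstacles shape the
  proof. The coboundary is given on arbitrary arguments, so it is first shown to be a derivation in
  each of them; doubling it makes the sum over pairs i < j symmetric enough for that. Weights are
  read off on lists of variables, and in a list that repeats i, a negative w_i no longer says that
  X_i does not divide X^alpha; skew symmetry handles such lists separately. Forms live in a quotient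
  by relations, so the independence of the dX_J must be proved: relations pair to zero with
  multiderivations, and determinants of partial derivatives separate the dX_J.\<close>

lemma quotient_isomorphicI:
  fixes s :: "'k::field \<Rightarrow> 'v::ab_group_add \<Rightarrow> 'v" and s' :: "'k \<Rightarrow> 'w::ab_group_add \<Rightarrow> 'w"
  assumes "Vector_Spaces.linear s s' \<Phi>"
    and "module.subspace s W" and "module.subspace s U" and "module.subspace s' U'"
    and U: "\<And>u. u \<in> U \<Longrightarrow> \<Phi> u \<in> U'"
    and ker: "\<And>w. w \<in> W \<Longrightarrow> \<Phi> w \<in> U' \<Longrightarrow> w \<in> U"
  shows "quotient_isomorphic s W U s' (\<Phi> ` W) U'"
proof -
  interpret \<Phi>: Vector_Spaces.linear s s' \<Phi> by fact
  note W_sub = \<Phi>.vs1.subspace_add[OF assms(2)] \<Phi>.vs1.subspace_diff[OF assms(2)]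
    \<Phi>.vs1.subspace_scale[OF assms(2)]
  note U_sub = \<Phi>.vs1.subspace_add[OF assms(3)] \<Phi>.vs1.subspace_diff[OF assms(3)]
    \<Phi>.vs1.subspace_scale[OF assms(3)] \<Phi>.vs1.subspace_0[OF assms(3)]
  note U'_sub = \<Phi>.vs2.subspace_add[OF assms(4)] \<Phi>.vs2.subspace_diff[OF assms(4)]
    \<Phi>.vs2.subspace_scale[OF assms(4)] \<Phi>.vs2.subspace_0[OF assms(4)]
  \<comment> \<open>The image of a coset of \<open>U\<close> may fill only part of a coset of
    \<open>U'\<close>; adding \<open>U'\<close> completes it, so the induced map is defined without
    choosing representatives.\<close>
  define \<phi> where "\<phi> A = \<Phi> ` A + U'" for A
  have cosetI: "x \<in> w +o U'" if "x - w \<in> U'" for x w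
    using that by (auto simp: elt_set_plus_def intro!: bexI[of _ "x - w"])
  have coset_iff: "x \<in> w +o U' \<longleftrightarrow> x - w \<in> U'" for x w
    using cosetI by (auto simp: elt_set_plus_def)
  have coset_iff1: "x \<in> w +o U \<longleftrightarrow> x - w \<in> U" for x w
    by (auto simp: elt_set_plus_def intro!: bexI[of _ "x - w"])
  have coset_eq: "v +o U' = w +o U' \<longleftrightarrow> v - w \<in> U'" for v w
  proof
    assume "v +o U' = w +o U'"
    moreover have "v \<in> v +o U'" using U'_sub by (simp add: coset_iff)
    ultimately show "v - w \<in> U'" by (simp add: coset_iff)
  next
    assume vw: "v - w \<in> U'"
    have "x - v \<in> U' \<longleftrightarrow> x - w \<in> U'" for x
      using U'_sub(1)[OF _ vw, of "x - v"] U'_sub(2)[OF _ vw, of "x - w"] by auto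
    then show "v +o U' = w +o U'" by (auto simp: coset_iff)
  qed
  have coset_eq1: "v +o U = w +o U" if vw: "v - w \<in> U" for v w
  proof -
    have "x - v \<in> U \<longleftrightarrow> x - w \<in> U" for x
      using U_sub(1)[OF _ vw, of "x - v"] U_sub(2)[OF _ vw, of "x - w"] by auto
    then show "v +o U = w +o U" by (auto simp: coset_iff1)
  qed
  have add': "(v +o U') + (w +o U') = (v + w) +o U'" for v w
  proof (rule set_eqI)
    fix x
    show "x \<in> (v +o U') + (w +o U') \<longleftrightarrow> x \<in> (v + w) +o U'"
      using U'_sub by (auto simp: elt_set_plus_def set_plus_def add_ac)
  qed
  have add1: "(v +o U) + (w +o U) = (v + w) +o U" for v w
  proof (rule set_eqI)
    fix x
    show "x \<in> (v +o U) + (w +o U) \<longleftrightarrow> x \<in> (v + w) +o U"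
      using U_sub by (auto simp: elt_set_plus_def set_plus_def add_ac)
  qed
  have \<phi>: "\<phi> (w +o U) = \<Phi> w +o U'" for w
  proof (rule set_eqI)
    fix x
    have "x \<in> \<phi> (w +o U) \<longleftrightarrow> (\<exists>u\<in>U. \<exists>u'\<in>U'. x = \<Phi> w + \<Phi> u + u')"
      by (auto simp: \<phi>_def elt_set_plus_def set_plus_def \<Phi>.add add.assoc) blast
    also have "\<dots> \<longleftrightarrow> x - \<Phi> w \<in> U'"
    proof
      assume "x - \<Phi> w \<in> U'"
      then show "\<exists>u\<in>U. \<exists>u'\<in>U'. x = \<Phi> w + \<Phi> u + u'"
        using U_sub(4) by (intro bexI[of _ 0] bexI[of _ "x - \<Phi> w"]) (auto simp: \<Phi>.zero)
    qed (use U U'_sub in \<open>auto simp: add_ac\<close>)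
    finally show "x \<in> \<phi> (w +o U) \<longleftrightarrow> x \<in> \<Phi> w +o U'" by (simp add: coset_iff)
  qed
  have scale1: "quotient_scale s U c (w +o U) = s c w +o U" for c w
  proof (rule set_eqI)
    fix x
    have "x \<in> quotient_scale s U c (w +o U) \<longleftrightarrow> (\<exists>u\<in>U. \<exists>v\<in>U. x = s c w + s c u + v)"
      by (auto simp: quotient_scale_def elt_set_plus_def set_plus_def \<Phi>.vs1.scale_right_distrib add.assoc) blast
    also have "\<dots> \<longleftrightarrow> x - s c w \<in> U"
    proof
      assume "x - s c w \<in> U"
      then show "\<exists>u\<in>U. \<exists>v\<in>U. x = s c w + s c u + v"
        using U_sub(4) by (intro bexI[of _ 0] bexI[of _ "x - s c w"]) auto
    qed (use U_sub in \<open>auto simp: add_ac\<close>)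
    finally show "x \<in> quotient_scale s U c (w +o U) \<longleftrightarrow> x \<in> s c w +o U" by (simp add: coset_iff1)
  qed
  have scale': "quotient_scale s' U' c (w +o U') = s' c w +o U'" for c w
  proof (rule set_eqI)
    fix x
    have "x \<in> quotient_scale s' U' c (w +o U') \<longleftrightarrow> (\<exists>u\<in>U'. \<exists>v\<in>U'. x = s' c w + s' c u + v)"
      by (auto simp: quotient_scale_def elt_set_plus_def set_plus_def \<Phi>.vs2.scale_right_distrib add.assoc) blast
    also have "\<dots> \<longleftrightarrow> x - s' c w \<in> U'"
    proof
      assume "x - s' c w \<in> U'"
      then show "\<exists>u\<in>U'. \<exists>v\<in>U'. x = s' c w + s' c u + v"
        using U'_sub(4) by (intro bexI[of _ 0] bexI[of _ "x - s' c w"]) auto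
    qed (use U'_sub in \<open>auto simp: add_ac\<close>)
    finally show "x \<in> quotient_scale s' U' c (w +o U') \<longleftrightarrow> x \<in> s' c w +o U'" by (simp add: coset_iff)
  qed
  have "inj_on \<phi> (quotient_space W U)"
    by (auto simp: inj_on_def quotient_space_def \<phi> coset_eq \<Phi>.diff[symmetric]
        intro!: coset_eq1 ker W_sub)
  moreover have "\<phi> ` quotient_space W U = quotient_space (\<Phi> ` W) U'"
    by (simp add: quotient_space_def image_image \<phi>)
  ultimately have "bij_betw \<phi> (quotient_space W U) (quotient_space (\<Phi> ` W) U')"
    by (simp add: bij_betw_def)
  moreover have "\<phi> (A + B) = \<phi> A + \<phi> B"
    if "A \<in> quotient_space W U" "B \<in> quotient_space W U" for A B
    using that by (auto simp: quotient_space_def add1 add' \<phi> \<Phi>.add)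
  moreover have "\<phi> (quotient_scale s U c A) = quotient_scale s' U' c (\<phi> A)"
    if "A \<in> quotient_space W U" for A c
    using that by (auto simp: quotient_space_def scale1 scale' \<phi> \<Phi>.scale)
  ultimately show ?thesis
    unfolding quotient_isomorphic_def by blast
qed

section \<open>Lists with one or two entries removed\<close>

lemma nths_remove_middle:
  "nths (us @ x # vs) (- {length us}) = us @ vs"
proof -
  have "nths (x # vs) {j. j \<noteq> (0::nat)} = vs"
    by (simp add: nths_Cons nths_all)
  moreover have "nths us (- {length us}) = us"
    by (subst nths_all) auto
  ultimately show ?thesis
    by (simp add: nths_append)
qed

lemma nths_remove2_middle:
  "nths (us @ x # vs @ y # ws) (- {length us, length us + Suc (length vs)}) = us @ vs @ ws"
proof -
  have "{j. j \<noteq> length vs} = - {length vs}" by auto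
  then have "nths (vs @ y # ws) {j. j \<noteq> length vs} = vs @ ws"
    by (simp add: nths_remove_middle)
  then have "nths (x # vs @ y # ws) {j. j \<noteq> (0::nat) \<and> j \<noteq> Suc (length vs)} = vs @ ws"
    by (simp add: nths_Cons nths_all)
  moreover have "nths us (- {length us, length us + Suc (length vs)}) = us"
    by (subst nths_all) auto
  ultimately show ?thesis
    by (simp add: nths_append)
qed

lemma list_split1:
  assumes "i < length xs"
  obtains us x vs where "xs = us @ x # vs" "length us = i"
  using assms id_take_nth_drop[of i xs] by (metis length_take min.absorb4)

lemma list_split2:
  assumes "i < j" "j < length xs"
  obtains us x vs y ws where "xs = us @ x # vs @ y # ws" "length us = i" "j = i + Suc (length vs)"
proof -
  obtain us' y ws where 1: "xs = us' @ y # ws" "length us' = j"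
    using assms list_split1 by blast
  then obtain us x vs where 2: "us' = us @ x # vs" "length us = i"
    using assms list_split1[of i us'] by blast
  show ?thesis
    using that[of us x vs y ws] 1 2 by simp
qed

lemma nths_remove_update_same: "nths (xs[i := y]) (- {i}) = nths xs (- {i})"
proof (cases "i < length xs")
  case True
  then obtain us x vs where "xs = us @ x # vs" "length us = i" using list_split1 by blast
  then show ?thesis
    using nths_remove_middle[of us] by (auto simp: list_update_append)
qed (simp add: list_update_beyond)

lemma length_nths_remove: "i < length xs \<Longrightarrow> length (nths xs (- {i})) = length xs - 1"
  by (erule list_split1) (auto simp: nths_remove_middle)

text \<open>The position \<open>l\<close> is fixed before \<open>y\<close>. Substitution into a
  shortened list is thus substitution into one slot, and the derivation property of a cochain
  carries over to it.\<close>

lemma nths_remove_update: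
  assumes "i \<noteq> j" "i < length xs" "j < length xs"
  obtains l where "l < length xs - 1"
    "\<And>y. nths (xs[j := y]) (- {i}) = (nths xs (- {i}))[l := y]"
proof (cases "i < j")
  case True
  then obtain us x vs y ws where xs: "xs = us @ x # vs @ y # ws" "length us = i" "j = i + Suc (length vs)"
    using assms list_split2 by blast
  have "xs[j := z] = us @ x # vs @ z # ws" for z
    by (simp add: xs list_update_append)
  then have "nths (xs[j := z]) (- {i}) = us @ vs @ z # ws" for z
    using nths_remove_middle[of us x "vs @ z # ws"] xs(2) by simp
  moreover have "nths xs (- {i}) = us @ vs @ y # ws"
    using nths_remove_middle[of us x "vs @ y # ws"] xs by simp
  ultimately show ?thesis
    by (intro that[of "length us + length vs"]) (auto simp: xs list_update_append)
next
  case False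
  then have "j < i" using assms by simp
  then obtain us x vs y ws where xs: "xs = us @ x # vs @ y # ws" "length us = j" "i = j + Suc (length vs)"
    using assms list_split2 by blast
  have "xs[j := z] = us @ z # vs @ y # ws" for z
    using xs(2) by (auto simp: xs(1) list_update_append)
  then have "nths (xs[j := z]) (- {i}) = us @ z # vs @ ws" for z
    using nths_remove_middle[of "us @ z # vs" y ws] xs(2,3) by simp
  moreover have "nths xs (- {i}) = us @ x # vs @ ws"
    using nths_remove_middle[of "us @ x # vs" y ws] xs by simp
  ultimately show ?thesis
    by (intro that[of "length us"]) (auto simp: xs list_update_append)
qed

lemma map_nths: "map f (nths xs I) = nths (map f xs) I"
  by (induction xs arbitrary: I) (auto simp: nths_Cons)

lemma count_list_remove:
  assumes "i < length xs"
  shows "count_list xs j = count_list (nths xs (- {i})) j + (if xs ! i = j then 1 else 0)"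
  using assms by (rule list_split1) (auto simp: nths_remove_middle)

section \<open>Multiderivations and the Poisson coboundary\<close>

context complex_algebra
begin

section \<open>Closure properties of derivations\<close>

lemma scale_mult_right: "f * sc c g = sc c (f * g)"
  by (metis mult.commute scale_mult_left)

lemma derivation_iff:
  "derivation sc D \<longleftrightarrow>
     (\<forall>f g. D (f + g) = D f + D g) \<and> (\<forall>c f. D (sc c f) = sc c (D f)) \<and>
     (\<forall>f g. D (f * g) = f * D g + g * D f)"
  using vector_space_axioms by (auto simp: derivation_def Vector_Spaces.linear_iff)

lemma
  assumes "derivation sc D"
  shows derivation_add: "D (f + g) = D f + D g"
    and derivation_scale: "D (sc c f) = sc c (D f)"
    and derivation_mult: "D (f * g) = f * D g + g * D f"
    and derivation_minus: "D (- f) = - D f"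
    and derivation_1: "D 1 = 0"
proof -
  show *: "D (f + g) = D f + D g" "D (sc c f) = sc c (D f)" "D (f * g) = f * D g + g * D f" for f g c
    using assms by (auto simp: derivation_iff)
  from *(2)[of 0 0] have 0: "D 0 = 0" by simp
  from *(1)[of f "- f"] 0 show "D (- f) = - D f" by (simp add: eq_neg_iff_add_eq_0 add.commute)
  from *(3)[of 1 1] show "D 1 = 0" by simp
qed

lemma derivation_plus:
  "derivation sc D \<Longrightarrow> derivation sc E \<Longrightarrow> derivation sc (\<lambda>x. D x + E x)"
  by (simp add: derivation_iff scale_right_distrib algebra_simps)

lemma derivation_times: "derivation sc D \<Longrightarrow> derivation sc (\<lambda>x. r * D x)"
  by (simp add: derivation_iff scale_mult_right algebra_simps)

lemma derivation_uminus: "derivation sc D \<Longrightarrow> derivation sc (\<lambda>x. - D x)"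
  using derivation_times[of D "-1"] by simp

lemma derivation_diff:
  "derivation sc D \<Longrightarrow> derivation sc E \<Longrightarrow> derivation sc (\<lambda>x. D x - E x)"
  by (simp add: derivation_iff scale_right_diff_distrib algebra_simps)

lemma derivation_zero: "derivation sc (\<lambda>x. 0)"
  by (simp add: derivation_iff)

lemma derivation_summation:
  "(\<And>i. i \<in> I \<Longrightarrow> derivation sc (D i)) \<Longrightarrow> derivation sc (\<lambda>x. \<Sum>i\<in>I. D i x)"
  by (induction I rule: infinite_finite_induct) (auto simp: derivation_zero derivation_plus)

text \<open>The mixed products such as \<open>E f * D g\<close> cancel in the difference. In the
  coboundary this makes {f_i, Q(g)} - Q({f_i, g}) a derivation in g, although the two terms
  separately are not.\<close>

lemma derivation_commutator:
  assumes "derivation sc D" "derivation sc E"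
  shows "derivation sc (\<lambda>x. D (E x) - E (D x))"
  using assms by (simp add: derivation_iff scale_right_diff_distrib algebra_simps)

text \<open>The scalar 2 is invertible. This turns skew symmetry into vanishing on repeated
  arguments, and it undoes the doubling in \<open>coboundary_double\<close>.\<close>

lemma double_eq_0:
  fixes x :: 'r
  shows "x + x = 0 \<Longrightarrow> x = 0"
proof -
  assume "x + x = 0"
  moreover have "x + x = sc 2 x"
    using scale_left_distrib[of 1 1 x] by simp
  ultimately show ?thesis by simp
qed

lemma double_inject:
  fixes x :: 'r
  shows "x + x = y + y \<Longrightarrow> x = y"
  using double_eq_0[of "x - y"] by (simp add: algebra_simps)

lemma derivation_halve:
  assumes "derivation sc (\<lambda>x. D x + D x)"
  shows "derivation sc D"
proof -
  have *: "D (f + g) + D (f + g) = (D f + D g) + (D f + D g)"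
    "D (sc c f) + D (sc c f) = sc c (D f) + sc c (D f)"
    "D (f * g) + D (f * g) = (f * D g + g * D f) + (f * D g + g * D f)" for f g c
    using derivation_add[OF assms, of f g] derivation_scale[OF assms, of c f] derivation_mult[OF assms, of f g]
    by (simp_all only: scale_right_distrib) (simp_all add: algebra_simps)
  show ?thesis
    unfolding derivation_iff using *[THEN double_inject] by blast
qed

section \<open>Sign rules for cochains\<close>

lemma
  assumes "P \<in> cochains sc k"
  shows cochain_arity: "length fs \<noteq> k \<Longrightarrow> P fs = 0"
    and cochain_derivation: "length fs = k \<Longrightarrow> i < k \<Longrightarrow> derivation sc (\<lambda>g. P (fs[i := g]))"
    and cochain_swap: "length fs = k \<Longrightarrow> i < j \<Longrightarrow> j < k \<Longrightarrow> P (fs[i := fs ! j, j := fs ! i]) = - P fs"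
proof -
  note * = assms[unfolded cochains_def mem_Collect_eq]
  show "length fs \<noteq> k \<Longrightarrow> P fs = 0"
    by (rule *[THEN conjunct1, rule_format])
  show "length fs = k \<Longrightarrow> i < k \<Longrightarrow> derivation sc (\<lambda>g. P (fs[i := g]))"
    by (rule *[THEN conjunct2, THEN conjunct1, rule_format]) (rule conjI)
  show "length fs = k \<Longrightarrow> i < j \<Longrightarrow> j < k \<Longrightarrow> P (fs[i := fs ! j, j := fs ! i]) = - P fs"
    by (rule *[THEN conjunct2, THEN conjunct2, rule_format]) (intro conjI)
qed

lemma cochain_derivation_middle:
  assumes "P \<in> cochains sc k" "length us + length vs + 1 = k"
  shows "derivation sc (\<lambda>g. P (us @ g # vs))"
  using cochain_derivation[OF assms(1), of "us @ 0 # vs" "length us"] assms(2)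
  by (simp add: list_update_append)

lemma cochain_swap_adjacent:
  assumes "P \<in> cochains sc k"
  shows "P (us @ x # y # vs) = - P (us @ y # x # vs)"
proof (cases "length us + length vs + 2 = k")
  case True
  then show ?thesis
    using cochain_swap[OF assms, of "us @ y # x # vs" "length us" "length us + 1"]
    by (simp add: list_update_append nth_append)
next
  case False
  then show ?thesis
    using cochain_arity[OF assms, of "us @ x # y # vs"] cochain_arity[OF assms, of "us @ y # x # vs"]
    by simp
qed

lemma cochain_move:
  assumes "P \<in> cochains sc k"
  shows "P (us @ vs @ x # ws) = (-1) ^ length vs * P (us @ x # vs @ ws)"
proof (induction vs arbitrary: us)
  case (Cons v vs)
  from Cons[of "us @ [v]"] cochain_swap_adjacent[OF assms, of us v x "vs @ ws"]
  show ?case by simp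
qed simp

text \<open>The sign of the rearrangement is left open: the result serves to carry vanishing
  coefficients from an increasing list to its rearrangements. The prefix \<open>us\<close> is there
  for the induction.\<close>

lemma cochain_permute:
  assumes "P \<in> cochains sc k" "mset xs = mset ys"
  shows "P (us @ xs) = P (us @ ys) \<or> P (us @ xs) = - P (us @ ys)"
  using assms(2)
proof (induction xs arbitrary: us ys)
  case (Cons x xs)
  then obtain as bs where ys: "ys = as @ x # bs"
    by (metis list.set_intros(1) mset_eq_setD split_list)
  with Cons have "P (us @ x # xs) = P (us @ x # as @ bs) \<or> P (us @ x # xs) = - P (us @ x # as @ bs)"
    using Cons.IH[of "as @ bs" "us @ [x]"] by simp
  moreover have "P (us @ ys) = (-1) ^ length as * P (us @ x # as @ bs)"
    unfolding ys by (rule cochain_move[OF assms(1)])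
  ultimately show ?case
    by (cases "even (length as)") auto
qed simp

lemma cochain_not_distinct:
  assumes "P \<in> cochains sc k" "\<not> distinct fs"
  shows "P fs = 0"
proof -
  obtain us x vs ws where fs: "fs = us @ [x] @ vs @ [x] @ ws"
    using not_distinct_decomp[OF assms(2)] by blast
  have "P (us @ x # x # vs @ ws) = 0"
    by (rule double_eq_0, rule eq_neg_iff_add_eq_0[THEN iffD1], rule cochain_swap_adjacent[OF assms(1)])
  then show ?thesis
    using cochain_move[OF assms(1), of "us @ [x]" vs x ws] by (simp add: fs)
qed

text \<open>Both sides list the entries other than those at \<open>i\<close> and \<open>j\<close>,
  together with \<open>x\<close>, which stands at the place of \<open>j\<close> on the left and at
  that of \<open>i\<close> on the right. It moves past the |j - i| - 1 entries between them; with
  the two explicit powers of -1 a single minus sign remains.\<close>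

lemma cochain_remove_update:
  assumes P: "P \<in> cochains sc k" and ij: "i \<noteq> j" "i < length fs" "j < length fs"
  shows "(-1) ^ i * P (nths (fs[j := x]) (- {i})) = - ((-1) ^ j * P (nths (fs[i := x]) (- {j})))"
proof -
  have *: "(-1) ^ i * P (nths (fs[j := x]) (- {i})) = - ((-1) ^ j * P (nths (fs[i := x]) (- {j})))"
    if ij: "i < j" "j < length fs" for i j
  proof -
    obtain us y vs z ws where fs: "fs = us @ y # vs @ z # ws"
      and i: "length us = i" and j: "j = i + Suc (length vs)"
      using ij list_split2 by blast
    have "fs[j := x] = us @ y # vs @ x # ws" "fs[i := x] = us @ x # vs @ z # ws"
      using i by (auto simp: fs j list_update_append)
    then have "nths (fs[j := x]) (- {i}) = us @ vs @ x # ws" "nths (fs[i := x]) (- {j}) = us @ x # vs @ ws"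
      using nths_remove_middle[of us y "vs @ x # ws"] nths_remove_middle[of "us @ x # vs" z ws] i j
      by auto
    then show ?thesis
      using cochain_move[OF P, of us vs x ws] by (simp add: j power_add)
  qed
  show ?thesis
    using *[of i j] *[of j i] ij by (metis linorder_neqE_nat minus_minus)
qed

text \<open>Moving \<open>x\<close> from the front to position \<open>i\<close> costs
  \<open>i\<close> transpositions. This rewrites the second sum of the coboundary in terms of lists
  with one entry removed, like the first sum.\<close>

lemma cochain_Cons_remove2:
  assumes P: "P \<in> cochains sc k" and ij: "i < j" "j < length fs"
  shows "P (x # nths fs (- {i, j})) = (-1) ^ i * P (nths (fs[i := x]) (- {j}))"
proof -
  obtain us y vs z ws where fs: "fs = us @ y # vs @ z # ws"
    and i: "length us = i" and j: "j = i + Suc (length vs)"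
    using ij list_split2 by blast
  have "nths fs (- {i, j}) = us @ vs @ ws"
    using nths_remove2_middle[of us y vs z ws] i j fs by simp
  moreover have "fs[i := x] = us @ x # vs @ z # ws"
    using i by (auto simp: fs j list_update_append)
  moreover have "nths (us @ x # vs @ z # ws) (- {j}) = us @ x # vs @ ws"
    using nths_remove_middle[of "us @ x # vs" z ws] i j by auto
  moreover have "(-1) ^ i * P (us @ x # (vs @ ws)) = ((-1) ^ i * (-1) ^ i) * P (x # us @ vs @ ws)"
    using cochain_move[OF P, of "[]" us x "vs @ ws"] i by simp
  ultimately show ?thesis
    by (simp add: power_add[symmetric])
qed

lemma derivation_cochain_remove:
  assumes P: "P \<in> cochains sc k" and "length fs = Suc k" "i \<noteq> j" "i \<le> k" "j \<le> k"
  shows "derivation sc (\<lambda>g. P (nths (fs[j := g]) (- {i})))"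
proof -
  obtain l where l: "l < length fs - 1"
    "\<And>y. nths (fs[j := y]) (- {i}) = (nths fs (- {i}))[l := y]"
    using nths_remove_update[of i j fs] assms by auto
  show ?thesis
    unfolding l(2) using assms l(1) by (intro cochain_derivation[OF P]) (auto simp: length_nths_remove)
qed

lemma vector_space_cochain_scale: "vector_space (cochain_scale sc)"
  by unfold_locales (simp_all add: cochain_scale_def fun_eq_iff algebra_simps)

lemma subspace_cochains: "module.subspace (cochain_scale sc) (cochains sc k)"
proof -
  interpret C: vector_space "cochain_scale sc" by (rule vector_space_cochain_scale)
  have D: "derivation sc (\<lambda>g. sc c (D g))" if "derivation sc D" for c D
    using that by (simp add: derivation_iff algebra_simps scale_mult_right)
  show ?thesis
    unfolding C.subspace_def
    by (auto simp: cochains_def derivation_zero cochain_scale_def intro!: derivation_plus D)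
qed

end

section \<open>The coboundary as a multiderivation\<close>

context poisson_algebra
begin

lemma br_right: "derivation sc (br f)"
  by (rule derivation_right)

lemma br_add_left: "br (f + g) h = br f h + br g h"
  using linear_left[of h] by (auto simp: Vector_Spaces.linear_iff)

lemma br_skew: "br f g = - br g f"
proof -
  have "br (f + g) (f + g) = (br f f + br f g) + (br g f + br g g)"
    by (simp only: br_add_left derivation_add[OF br_right] add_ac)
  then show ?thesis
    by (simp add: alternating eq_neg_iff_add_eq_0)
qed

lemma br_left: "derivation sc (\<lambda>f. br f g)"
  using derivation_uminus[OF br_right[of g]] by (simp add: br_skew[of _ g])

text \<open>Each pair \<open>i < j\<close> in the second sum is split symmetrically between \<open>(i, j)\<close> and
  \<open>(j, i)\<close>; this is why the coboundary appears twice.\<close>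

lemma coboundary_double:
  assumes P: "P \<in> cochains sc k" and len: "length fs = Suc k"
  shows "coboundary br k P fs + coboundary br k P fs =
    (\<Sum>i\<le>k. (-1) ^ i * (br (fs ! i) (P (nths fs (- {i}))) + br (fs ! i) (P (nths fs (- {i})))
       - (\<Sum>j\<in>{..k} - {i}. P (nths (fs[j := br (fs ! i) (fs ! j)]) (- {i})))))"
proof -
  define T where "T i j = (-1) ^ i * P (nths (fs[j := br (fs ! i) (fs ! j)]) (- {i}))" for i j
  have T: "(-1) ^ (i + j) * P (br (fs ! i) (fs ! j) # nths fs (- {i, j})) = - T i j"
    "T j i = T i j" if "i < j" "j \<le> k" for i j
  proof -
    note rem = cochain_remove_update[OF P, of i j fs]
    have "(-1) ^ (i + j) * P (br (fs ! i) (fs ! j) # nths fs (- {i, j}))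
      = ((-1) ^ i * (-1) ^ i) * ((-1) ^ j * P (nths (fs[i := br (fs ! i) (fs ! j)]) (- {j})))"
      using cochain_Cons_remove2[OF P, of i j fs] that len by (simp add: power_add algebra_simps)
    also have "\<dots> = (-1) ^ j * P (nths (fs[i := br (fs ! i) (fs ! j)]) (- {j}))"
      by (simp add: power_add[symmetric])
    finally have 1: "(-1) ^ (i + j) * P (br (fs ! i) (fs ! j) # nths fs (- {i, j})) =
      (-1) ^ j * P (nths (fs[i := br (fs ! i) (fs ! j)]) (- {j}))" .
    show "(-1) ^ (i + j) * P (br (fs ! i) (fs ! j) # nths fs (- {i, j})) = - T i j"
      unfolding 1 T_def using rem[of "br (fs ! i) (fs ! j)"] that len by simp
    \<comment> \<open>Exchanging \<open>i\<close> and \<open>j\<close> changes the sign twice, in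
      the bracket and in \<open>cochain_remove_update\<close>, so \<open>T\<close> is
      symmetric.\<close>
    have "P (nths (fs[i := br (fs ! j) (fs ! i)]) (- {j})) = - P (nths (fs[i := br (fs ! i) (fs ! j)]) (- {j}))"
      using derivation_minus[OF derivation_cochain_remove[OF P len, of j i], of "br (fs ! i) (fs ! j)"]
        br_skew[of "fs ! j" "fs ! i"] that by simp
    then show "T j i = T i j"
      unfolding T_def using rem[of "br (fs ! i) (fs ! j)"] that len by simp
  qed
  have "(\<Sum>i\<le>k. \<Sum>j\<in>{..k} - {i}. T i j) = (\<Sum>i\<le>k. (\<Sum>j<i. T i j) + (\<Sum>j\<in>{i<..k}. T i j))"
  proof (rule sum.cong)
    fix i assume "i \<in> {..k}"
    then have "{..k} - {i} = {..<i} \<union> {i<..k}" by auto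
    then show "(\<Sum>j\<in>{..k} - {i}. T i j) = (\<Sum>j<i. T i j) + (\<Sum>j\<in>{i<..k}. T i j)"
      by (simp add: sum.union_disjoint[symmetric] Int_commute disjoint_iff)
  qed simp
  also have "\<dots> = (\<Sum>i\<le>k. \<Sum>j<i. T i j) + (\<Sum>i\<le>k. \<Sum>j\<in>{i<..k}. T i j)"
    by (rule sum.distrib)
  also have "(\<Sum>i\<le>k. \<Sum>j\<in>{i<..k}. T i j) = (\<Sum>j\<le>k. \<Sum>i<j. T i j)"
    unfolding sum.Sigma[OF finite_atMost ballI[OF finite_greaterThanAtMost]]
      sum.Sigma[OF finite_atMost ballI[OF finite_lessThan]]
    by (rule sum.reindex_bij_witness[of _ prod.swap prod.swap]) auto
  also have "(\<Sum>i\<le>k. \<Sum>j<i. T i j) = (\<Sum>j\<le>k. \<Sum>i<j. T i j)"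
    by (intro sum.cong refl) (use T in auto)
  finally have pairs: "(\<Sum>i\<le>k. \<Sum>j\<in>{..k} - {i}. T i j) = (\<Sum>j\<le>k. \<Sum>i<j. T i j) + (\<Sum>j\<le>k. \<Sum>i<j. T i j)" .
  have "(\<Sum>j\<le>k. \<Sum>i<j. (-1) ^ (i + j) * P (br (fs ! i) (fs ! j) # nths fs (- {i, j})))
    = (\<Sum>j\<le>k. \<Sum>i<j. - T i j)"
    by (intro sum.cong refl T) auto
  then have "coboundary br k P fs = (\<Sum>i\<le>k. (-1) ^ i * br (fs ! i) (P (nths fs (- {i})))) - (\<Sum>j\<le>k. \<Sum>i<j. T i j)"
    using len by (simp add: coboundary_def sum_negf)
  then have "coboundary br k P fs + coboundary br k P fs =
    (\<Sum>i\<le>k. (-1) ^ i * br (fs ! i) (P (nths fs (- {i})))) + (\<Sum>i\<le>k. (-1) ^ i * br (fs ! i) (P (nths fs (- {i}))))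
     - (\<Sum>i\<le>k. \<Sum>j\<in>{..k} - {i}. T i j)"
    unfolding pairs by simp
  also have "\<dots> = (\<Sum>i\<le>k. (-1) ^ i * (br (fs ! i) (P (nths fs (- {i}))) + br (fs ! i) (P (nths fs (- {i})))
       - (\<Sum>j\<in>{..k} - {i}. P (nths (fs[j := br (fs ! i) (fs ! j)]) (- {i})))))"
    by (simp add: T_def sum.distrib sum_subtractf algebra_simps sum_distrib_left)
  finally show ?thesis .
qed

text \<open>In the doubled coboundary as a function of g at position \<open>m\<close>, the summand
  with index \<open>m\<close> gives {g, P(...)}. Every other index contributes two commutators of
  the derivations {f_i, -} and \<open>Q i\<close>, and further terms in which g is a plain argument
  of P. \<open>?D\<close> is the result of this grouping.\<close>

lemma derivation_coboundary:
  assumes P: "P \<in> cochains sc k" and len: "length fs = Suc k" and m: "m \<le> k"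
  shows "derivation sc (\<lambda>g. coboundary br k P (fs[m := g]))"
proof (rule derivation_halve)
  define Q where "Q i g = P (nths (fs[m := g]) (- {i}))" for i g
  define Pm where "Pm = P (nths fs (- {m}))"
  have Q: "derivation sc (Q i)" if "i \<le> k" "i \<noteq> m" for i
    unfolding Q_def using derivation_cochain_remove[OF P len] that m by simp
  let ?D = "\<lambda>g. (-1) ^ m * (br g Pm + br g Pm) +
     (\<Sum>i\<in>{..k} - {m}. (-1) ^ i * ((br (fs ! i) (Q i g) - Q i (br (fs ! i) g)) + (br (fs ! i) (Q i g) - Q i (br (fs ! i) g))
        - (\<Sum>j\<in>{..k} - {i} - {m}. P (nths (fs[j := br (fs ! i) (fs ! j), m := g]) (- {i})))))"
  have eq: "coboundary br k P (fs[m := g]) + coboundary br k P (fs[m := g]) = ?D g" for g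
  proof -
    let ?f = "fs[m := g]"
    let ?S = "\<lambda>i. (-1) ^ i * (br (?f ! i) (P (nths ?f (- {i}))) + br (?f ! i) (P (nths ?f (- {i})))
       - (\<Sum>j\<in>{..k} - {i}. P (nths (?f[j := br (?f ! i) (?f ! j)]) (- {i}))))"
    have nth: "?f ! m = g" "\<And>j. j \<noteq> m \<Longrightarrow> ?f ! j = fs ! j" using m len by auto
    \<comment> \<open>The summand with index \<open>m\<close> pairs g with every other argument. Its
      part for \<open>j\<close> is handed to index \<open>j\<close>, which thereby gets the second
      copy of \<open>Q j (br (fs ! j) g)\<close> that its two commutators require.\<close>
    have flip: "(-1) ^ m * P (nths (?f[j := br g (?f ! j)]) (- {m})) = (-1) ^ j * Q j (br (fs ! j) g)"
      if j: "j \<in> {..k} - {m}" for j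
    proof -
      have "(-1) ^ m * P (nths (?f[j := br g (?f ! j)]) (- {m}))
        = - ((-1) ^ j * P (nths (?f[m := br g (?f ! j)]) (- {j})))"
        using cochain_remove_update[OF P, of m j ?f] j m len by simp
      also have "P (nths (?f[m := br g (?f ! j)]) (- {j})) = Q j (br g (fs ! j))"
        using j by (simp add: Q_def)
      also have "\<dots> = - Q j (br (fs ! j) g)"
        using derivation_minus[OF Q] j br_skew[of g "fs ! j"] by simp
      finally show ?thesis by simp
    qed
    have "P (nths ?f (- {m})) = Pm"
      by (simp add: Pm_def nths_remove_update_same)
    then have Sm: "?S m = (-1) ^ m * (br g Pm + br g Pm) - (\<Sum>j\<in>{..k} - {m}. (-1) ^ j * Q j (br (fs ! j) g))"
      using flip by (simp add: nth right_diff_distrib sum_distrib_left del: minus_mult_minus)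
    have Si: "?S i = (-1) ^ i * (br (fs ! i) (Q i g) + br (fs ! i) (Q i g) - Q i (br (fs ! i) g)
        - (\<Sum>j\<in>{..k} - {i} - {m}. P (nths (fs[j := br (fs ! i) (fs ! j), m := g]) (- {i}))))"
      if i: "i \<in> {..k} - {m}" for i
    proof -
      have "(\<Sum>j\<in>{..k} - {i}. P (nths (?f[j := br (?f ! i) (?f ! j)]) (- {i}))) =
        P (nths (?f[m := br (?f ! i) (?f ! m)]) (- {i})) +
        (\<Sum>j\<in>{..k} - {i} - {m}. P (nths (?f[j := br (?f ! i) (?f ! j)]) (- {i})))"
        by (rule sum.remove) (use i m in auto)
      also have "(\<Sum>j\<in>{..k} - {i} - {m}. P (nths (?f[j := br (?f ! i) (?f ! j)]) (- {i}))) =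
        (\<Sum>j\<in>{..k} - {i} - {m}. P (nths (fs[j := br (fs ! i) (fs ! j), m := g]) (- {i})))"
      proof (rule sum.cong)
        fix j assume "j \<in> {..k} - {i} - {m}"
        then show "P (nths (?f[j := br (?f ! i) (?f ! j)]) (- {i})) =
          P (nths (fs[j := br (fs ! i) (fs ! j), m := g]) (- {i}))"
          using nth(2) i list_update_swap[of m j fs g] by auto
      qed simp
      finally show ?thesis
        using i nth by (simp add: Q_def diff_diff_eq)
    qed
    have "coboundary br k P ?f + coboundary br k P ?f = sum ?S {..k}"
      using coboundary_double[OF P, of ?f] len by simp
    also have "\<dots> = ?S m + sum ?S ({..k} - {m})"
      by (rule sum.remove) (use m in auto)
    also have "sum ?S ({..k} - {m}) = (\<Sum>i\<in>{..k} - {m}. (-1) ^ i * (br (fs ! i) (Q i g) + br (fs ! i) (Q i g) - Q i (br (fs ! i) g)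
        - (\<Sum>j\<in>{..k} - {i} - {m}. P (nths (fs[j := br (fs ! i) (fs ! j), m := g]) (- {i})))))"
      by (rule sum.cong) (use Si in auto)
    finally show ?thesis
      unfolding Sm by (simp add: sum.distrib sum_subtractf sum_distrib_left algebra_simps)
  qed
  have "derivation sc ?D"
  proof (intro derivation_plus derivation_times derivation_summation br_left, goal_cases)
    case (1 i)
    then have i: "i \<le> k" "i \<noteq> m" by auto
    have c: "derivation sc (\<lambda>g. br (fs ! i) (Q i g) - Q i (br (fs ! i) g))"
      by (rule derivation_commutator[OF br_right Q[OF i]])
    have "derivation sc (\<lambda>g. \<Sum>j\<in>{..k} - {i} - {m}.
        P (nths (fs[j := br (fs ! i) (fs ! j), m := g]) (- {i})))"
      by (rule derivation_summation, rule derivation_cochain_remove[OF P]) (use i m len in auto)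
    then show ?case
      by (rule derivation_diff[OF derivation_plus[OF c c]])
  qed
  then show "derivation sc (\<lambda>g. coboundary br k P (fs[m := g]) + coboundary br k P (fs[m := g]))"
    by (simp only: eq)
qed

lemma linear_coboundary:
  "Vector_Spaces.linear (cochain_scale sc) (cochain_scale sc) (coboundary br k)"
  unfolding Vector_Spaces.linear_iff
proof (intro conjI allI vector_space_cochain_scale ext)
  fix P Q :: "'r list \<Rightarrow> 'r" and fs c
  show "coboundary br k (P + Q) fs = (coboundary br k P + coboundary br k Q) fs"
    by (simp add: coboundary_def derivation_add[OF br_right] sum.distrib algebra_simps)
  show "coboundary br k (cochain_scale sc c P) fs = cochain_scale sc c (coboundary br k P) fs"
    by (simp add: coboundary_def cochain_scale_def derivation_scale[OF br_right] scale_mult_right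
        scale_right_distrib scale_sum_right)
qed

lemma subspace_cocycles: "module.subspace (cochain_scale sc) (cocycles sc br k)"
proof -
  interpret L: Vector_Spaces.linear "cochain_scale sc" "cochain_scale sc" "coboundary br k"
    by (rule linear_coboundary)
  have "cocycles sc br k = cochains sc k \<inter> {P. coboundary br k P = 0}"
    by (auto simp: cocycles_def)
  then show ?thesis
    by (simp add: L.vs1.subspace_inter[OF subspace_cochains] L.subspace_kernel)
qed

lemma subspace_coboundaries: "module.subspace (cochain_scale sc) (coboundaries sc br k)"
proof -
  interpret C: vector_space "cochain_scale sc" by (rule vector_space_cochain_scale)
  show ?thesis
  proof (cases k)
    case 0
    then show ?thesis by (simp add: C.subspace_def)
  next
    case (Suc l)
    interpret L: Vector_Spaces.linear "cochain_scale sc" "cochain_scale sc" "coboundary br l"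
      by (rule linear_coboundary)
    from Suc show ?thesis by (simp add: L.subspace_image[OF subspace_cochains])
  qed
qed

end

section \<open>Multiderivations of the polynomial ring\<close>

lemma poly_mapping_single_induct [case_names single add]:
  fixes f :: "'a \<Rightarrow>\<^sub>0 'b::comm_monoid_add"
  assumes "\<And>a c. Q (Poly_Mapping.single a c)" and "\<And>f g. Q f \<Longrightarrow> Q g \<Longrightarrow> Q (f + g)"
  shows "Q f"
proof -
  have "Q (\<Sum>a\<in>A. Poly_Mapping.single a (Poly_Mapping.lookup f a))" for A
  proof (induction A rule: infinite_finite_induct)
    case (infinite A)
    \<comment> \<open>A single term with coefficient 0 is the zero mapping, so \<open>Q 0\<close> is
      an instance of the first case.\<close>
    then show ?case using assms(1)[of undefined 0] by simp
  next
    case empty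
    then show ?case using assms(1)[of undefined 0] by simp
  qed (simp add: assms)
  moreover have "(\<Sum>a\<in>Poly_Mapping.keys f. Poly_Mapping.single a (Poly_Mapping.lookup f a)) = f"
    by (rule poly_mapping_eqI) (simp add: lookup_sum lookup_single when_def in_keys_iff)
  ultimately show ?thesis by metis
qed

lemma lookup_pscale [simp]: "Poly_Mapping.lookup (pscale c f) \<alpha> = c * Poly_Mapping.lookup f \<alpha>"
  by (simp add: pscale_def map.rep_eq when_def)

lemma mult_pscale: "pscale c f * g = pscale c (f * g)"
  by (simp add: pscale_def mult_map_scale_conv_mult mult.assoc)

interpretation cpoly: complex_algebra pscale
  by unfold_locales (simp add: mult_pscale | rule poly_mapping_eqI, simp add: lookup_add algebra_simps)+

definition unit_exp :: "'n \<Rightarrow> 'n \<Rightarrow>\<^sub>0 nat" where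
  "unit_exp i = Poly_Mapping.single i 1"

lemma lookup_unit_exp [simp]: "Poly_Mapping.lookup (unit_exp i) j = (if i = j then 1 else 0)"
  by (simp add: unit_exp_def lookup_single when_def)

lemma X_eq_single: "X i = Poly_Mapping.single (unit_exp i) 1"
  by (simp add: X_def X_pow_def unit_exp_def)

lemma inj_add_exp: "inj (\<lambda>\<alpha> :: 'n \<Rightarrow>\<^sub>0 nat. \<alpha> + \<epsilon>)"
  by (simp add: inj_def)

lemma add_diff_unit_exp: "Poly_Mapping.lookup \<alpha> i \<noteq> 0 \<Longrightarrow> \<alpha> - unit_exp i + unit_exp i = \<alpha>"
  by (rule poly_mapping_eqI) (auto simp: lookup_add lookup_minus lookup_single when_def)

lemma add_unit_exp_eq_iff:
  "\<alpha> + unit_exp i = \<beta> \<longleftrightarrow> Poly_Mapping.lookup \<beta> i \<noteq> 0 \<and> \<alpha> = \<beta> - unit_exp i"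
  by (auto simp: add_diff_unit_exp lookup_add intro!: poly_mapping_eqI)

lemma lookup_X: "Poly_Mapping.lookup (X i) \<alpha> = (if \<alpha> = unit_exp i then 1 else 0)"
  by (auto simp: X_eq_single lookup_single when_def)

lemma X_pow_0: "X_pow 0 = 1"
  by (simp add: X_pow_def)

lemma X_pow_add: "X_pow (\<alpha> + \<beta>) = X_pow \<alpha> * X_pow \<beta>"
  by (simp add: X_pow_def mult_single)

lemma cpoly_monomial: "Poly_Mapping.single \<alpha> c = pscale c (X_pow \<alpha>)"
  by (rule poly_mapping_eqI) (simp add: X_pow_def lookup_single when_def)

lemma lookup_X_mult:
  "Poly_Mapping.lookup (X i * f) \<alpha> =
     (if Poly_Mapping.lookup \<alpha> i = 0 then 0 else Poly_Mapping.lookup f (\<alpha> - unit_exp i))"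
proof (induction f rule: poly_mapping_single_induct)
  case (single a c)
  then show ?case
    using add_unit_exp_eq_iff[of a i \<alpha>]
    by (auto simp: X_eq_single mult_single lookup_single when_def add.commute)
next
  case (add f g)
  then show ?case by (simp add: distrib_left lookup_add)
qed

lemma derivation_eqI:
  assumes D: "derivation pscale D" and E: "derivation pscale E"
    and X: "\<And>i. D (X i) = E (X i)"
  shows "D f = E f"
proof (induction f rule: poly_mapping_single_induct)
  case (single \<alpha> c)
  have "D (X_pow \<alpha>) = E (X_pow \<alpha>)"
  proof (induction \<alpha> rule: poly_mapping_single_induct)
    case (single i m)
    show ?case
    proof (induction m)
      case 0
      then show ?case
        by (simp add: X_pow_0 cpoly.derivation_1[OF D] cpoly.derivation_1[OF E])
    next
      case (Suc m)
      have "X_pow (Poly_Mapping.single i (Suc m)) = X i * X_pow (Poly_Mapping.single i m)"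
        by (simp add: X_def X_pow_add[symmetric] single_add[symmetric])
      then show ?case
        by (simp add: cpoly.derivation_mult[OF D] cpoly.derivation_mult[OF E] Suc X)
    qed
  next
    case (add f g)
    then show ?case
      by (simp add: X_pow_add cpoly.derivation_mult[OF D] cpoly.derivation_mult[OF E])
  qed
  then show ?case
    by (simp add: cpoly_monomial cpoly.derivation_scale[OF D] cpoly.derivation_scale[OF E])
next
  case (add f g)
  then show ?case
    by (simp add: cpoly.derivation_add[OF D] cpoly.derivation_add[OF E])
qed

section \<open>Partial derivatives\<close>

definition partial :: "'n \<Rightarrow> 'n cpoly \<Rightarrow> 'n cpoly" where
  "partial i f = Abs_poly_mapping
     (\<lambda>\<alpha>. of_nat (Suc (Poly_Mapping.lookup \<alpha> i)) * Poly_Mapping.lookup f (\<alpha> + unit_exp i))"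

lemma finite_shifted_support:
  fixes f :: "'n cpoly"
  shows "finite {\<alpha>. Poly_Mapping.lookup f (\<alpha> + \<epsilon>) \<noteq> 0}"
  using finite_vimageI[OF finite_lookup[of f] inj_add_exp[of \<epsilon>]] by (simp add: vimage_def)

lemma lookup_partial:
  "Poly_Mapping.lookup (partial i f) \<alpha> =
     of_nat (Suc (Poly_Mapping.lookup \<alpha> i)) * Poly_Mapping.lookup f (\<alpha> + unit_exp i)"
  unfolding partial_def
  by (subst lookup_Abs_poly_mapping) (auto intro: finite_subset[OF _ finite_shifted_support[of f]])

lemma lookup_X_mult_partial:
  "Poly_Mapping.lookup (X i * partial i f) \<alpha> =
     of_nat (Poly_Mapping.lookup \<alpha> i) * Poly_Mapping.lookup f \<alpha>"
  by (auto simp: lookup_X_mult lookup_partial lookup_minus add_diff_unit_exp simp del: of_nat_Suc)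

lemma X_mult_cancel:
  assumes "X i * f = X i * g"
  shows "f = g"
proof (rule poly_mapping_eqI)
  fix \<alpha>
  have "Poly_Mapping.lookup (X i * f) (\<alpha> + unit_exp i) = Poly_Mapping.lookup (X i * g) (\<alpha> + unit_exp i)"
    using assms by simp
  then show "Poly_Mapping.lookup f \<alpha> = Poly_Mapping.lookup g \<alpha>"
    by (simp add: lookup_X_mult lookup_add)
qed

lemma partial_add: "partial i (f + g) = partial i f + partial i g"
  by (rule poly_mapping_eqI) (simp add: lookup_partial lookup_add algebra_simps)

text \<open>The Leibniz rule is checked for the Euler operator \<open>X i * partial i\<close>, which is diagonal on
  monomials.\<close>

lemma derivation_partial: "derivation pscale (partial i)"
  unfolding cpoly.derivation_iff
proof (intro conjI allI)
  fix f g :: "'a cpoly" and c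
  show "partial i (f + g) = partial i f + partial i g"
    by (rule partial_add)
  show "partial i (pscale c f) = pscale c (partial i f)"
    by (rule poly_mapping_eqI) (simp add: lookup_partial)
  have euler: "X i * partial i (Poly_Mapping.single \<alpha> d) =
      Poly_Mapping.single \<alpha> (of_nat (Poly_Mapping.lookup \<alpha> i) * d)" for \<alpha> d
    by (rule poly_mapping_eqI) (simp add: lookup_X_mult_partial lookup_single when_def)
  have "X i * partial i (f * g) = X i * (f * partial i g + g * partial i f)"
  proof (induction f rule: poly_mapping_single_induct)
    case (single \<alpha> d)
    show ?case
    proof (induction g rule: poly_mapping_single_induct)
      case (single \<beta> e)
      have "X i * (Poly_Mapping.single \<alpha> d * partial i (Poly_Mapping.single \<beta> e) +
          Poly_Mapping.single \<beta> e * partial i (Poly_Mapping.single \<alpha> d)) =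
        Poly_Mapping.single \<alpha> d * (X i * partial i (Poly_Mapping.single \<beta> e)) +
          Poly_Mapping.single \<beta> e * (X i * partial i (Poly_Mapping.single \<alpha> d))"
        by (simp add: algebra_simps)
      then show ?case
        by (simp add: euler mult_single lookup_add single_add[symmetric] algebra_simps)
    next
      case (add f g)
      then show ?case by (simp add: partial_add algebra_simps)
    qed
  next
    case (add f g)
    then show ?case by (simp add: partial_add algebra_simps)
  qed
  then show "partial i (f * g) = f * partial i g + g * partial i f"
    by (rule X_mult_cancel)
qed

lemma partial_X: "partial i (X j) = (if i = j then 1 else 0)"
proof (rule X_mult_cancel[of i], rule poly_mapping_eqI)
  fix \<alpha>
  show "Poly_Mapping.lookup (X i * partial i (X j)) \<alpha> =
    Poly_Mapping.lookup (X i * (if i = j then 1 else 0)) \<alpha>"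
    by (auto simp: lookup_X_mult_partial lookup_X)
qed

text \<open>A skew-symmetric function of lists of variables extends to a unique cochain.\<close>

definition skew_on_lists :: "nat \<Rightarrow> ('n list \<Rightarrow> 'n cpoly) \<Rightarrow> bool" where
  "skew_on_lists k q \<longleftrightarrow> (\<forall>is i j. length is = k \<longrightarrow> i < j \<longrightarrow> j < k \<longrightarrow>
     q (is[i := is ! j, j := is ! i]) = - q is)"

text \<open>The sum runs over all lists of indices, not only increasing ones. On variables exactly
  one product of partials survives, so the value is \<open>q\<close> itself without a factor 1/k!,
  and skew symmetry is a reindexing of the sum.\<close>

definition cochain_of :: "nat \<Rightarrow> ('n list \<Rightarrow> 'n::finite cpoly) \<Rightarrow> 'n cpoly list \<Rightarrow> 'n cpoly" where
  "cochain_of k q fs =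
     (if length fs = k then \<Sum>js | length js = k. q js * (\<Prod>l<k. partial (js ! l) (fs ! l)) else 0)"

lemma finite_lists_of_length: "finite {js :: 'n::finite list. length js = k}"
  using finite_lists_length_eq[of "UNIV :: 'n set" k] by simp

lemma cochain_of_in_cochains:
  fixes q :: "'n list \<Rightarrow> 'n::finite cpoly"
  assumes "skew_on_lists k q"
  shows "cochain_of k q \<in> cochains pscale k"
  unfolding cochains_def
proof (intro CollectI conjI allI impI)
  fix fs :: "'n cpoly list"
  assume "length fs \<noteq> k"
  then show "cochain_of k q fs = 0" by (simp add: cochain_of_def)
next
  fix fs :: "'n cpoly list" and i
  assume A: "length fs = k \<and> i < k"
  have "cochain_of k q (fs[i := g]) =
    (\<Sum>js | length js = k. (q js * (\<Prod>l\<in>{..<k} - {i}. partial (js ! l) (fs ! l))) * partial (js ! i) g)" for g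
  proof -
    have "(\<Prod>l<k. partial (js ! l) (fs[i := g] ! l)) =
      partial (js ! i) g * (\<Prod>l\<in>{..<k} - {i}. partial (js ! l) (fs ! l))" for js
    proof -
      have "(\<Prod>l\<in>{..<k} - {i}. partial (js ! l) (fs[i := g] ! l)) =
        (\<Prod>l\<in>{..<k} - {i}. partial (js ! l) (fs ! l))"
        by (rule prod.cong) auto
      then show ?thesis
        using A by (subst prod.remove[of _ i]) auto
    qed
    then show ?thesis
      using A by (simp add: cochain_of_def algebra_simps)
  qed
  moreover have "derivation pscale (\<lambda>g. \<Sum>js | length js = k.
      (q js * (\<Prod>l\<in>{..<k} - {i}. partial (js ! l) (fs ! l))) * partial (js ! i) g)"
    by (intro cpoly.derivation_summation cpoly.derivation_times derivation_partial)
  ultimately show "derivation pscale (\<lambda>g. cochain_of k q (fs[i := g]))" by presburger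
next
  fix fs :: "'n cpoly list" and i j
  assume A: "length fs = k \<and> i < j \<and> j < k"
  \<comment> \<open>The swap is applied to the indices as well as to the arguments: the product is
    then only reordered, and the sign comes from \<open>q\<close>.\<close>
  define sw where "sw js = js[i := js ! j, j := js ! i]" for js :: "'n list"
  define gs where "gs = fs[i := fs ! j, j := fs ! i]"
  let ?t = "Transposition.transpose i j"
  have t: "bij_betw ?t {..<k} {..<k}"
    using A by (intro permutes_imp_bij permutes_swap_id) auto
  have sw: "sw (sw js) = js" if "length js = k" for js
    using that A by (intro nth_equalityI) (auto simp: sw_def nth_list_update)
  have nth: "sw js ! l = js ! ?t l" "gs ! l = fs ! ?t l" if "length js = k" "l < k" for js l
    using that A by (auto simp: sw_def gs_def nth_list_update Transposition.transpose_def)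
  have "cochain_of k q gs = (\<Sum>js | length js = k. q js * (\<Prod>l<k. partial (js ! l) (gs ! l)))"
    using A by (simp add: cochain_of_def gs_def)
  also have "\<dots> = (\<Sum>js | length js = k. q (sw js) * (\<Prod>l<k. partial (sw js ! l) (gs ! l)))"
    by (rule sum.reindex_bij_witness[of _ sw sw]) (use sw in \<open>auto simp: sw_def\<close>)
  also have "\<dots> = (\<Sum>js | length js = k. - (q js * (\<Prod>l<k. partial (js ! l) (fs ! l))))"
  proof (rule sum.cong)
    fix js :: "'n list" assume "js \<in> {js. length js = k}"
    then have js: "length js = k" by simp
    have "(\<Prod>l<k. partial (sw js ! l) (gs ! l)) = (\<Prod>l<k. partial (js ! ?t l) (fs ! ?t l))"
      by (rule prod.cong) (use js nth in auto)
    also have "\<dots> = (\<Prod>l<k. partial (js ! l) (fs ! l))"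
      using prod.reindex_bij_betw[OF t, of "\<lambda>l. partial (js ! l) (fs ! l)"] by simp
    finally show "q (sw js) * (\<Prod>l<k. partial (sw js ! l) (gs ! l)) = - (q js * (\<Prod>l<k. partial (js ! l) (fs ! l)))"
      using assms js A by (simp add: skew_on_lists_def sw_def)
  qed simp
  finally show "cochain_of k q (fs[i := fs ! j, j := fs ! i]) = - cochain_of k q fs"
    using A by (simp add: cochain_of_def gs_def sum_negf)
qed

lemma cochain_of_variables:
  assumes "length is = k"
  shows "cochain_of k q (map X is) = q is"
proof -
  have "(\<Prod>l<k. partial (js ! l) (map X is ! l)) = (if js = is then 1 else 0)" if js: "length js = k" for js
  proof (cases "js = is")
    case True
    then show ?thesis using assms by (auto simp: partial_X intro!: prod.neutral)
  next
    case False
    then obtain l where "l < k" "js ! l \<noteq> is ! l"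
      using js assms nth_equalityI[of js "is"] by metis
    then show ?thesis
      using False assms by (auto simp: partial_X intro!: prod_zero)
  qed
  then have "cochain_of k q (map X is) = (\<Sum>js | length js = k. if is = js then q js else 0)"
    unfolding cochain_of_def using assms by (auto intro!: sum.cong)
  then show ?thesis
    using assms by (simp add: finite_lists_of_length)
qed

text \<open>The hypotheses ask for a derivation in each slot, which
  \<open>derivation_coboundary\<close> supplies for coboundaries. So values on variables also decide
  equations between cochains and coboundaries.\<close>

lemma multiderivation_eqI:
  assumes P: "\<And>fs i. length fs = k \<Longrightarrow> i < k \<Longrightarrow> derivation pscale (\<lambda>g. P (fs[i := g]))"
    and Q: "\<And>fs i. length fs = k \<Longrightarrow> i < k \<Longrightarrow> derivation pscale (\<lambda>g. Q (fs[i := g]))"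
    and eq: "\<And>is. length is = k \<Longrightarrow> P (map X is) = Q (map X is)"
    and len: "length fs = k"
  shows "P fs = Q fs"
proof -
  \<comment> \<open>The arbitrary arguments form a prefix. \<open>derivation_eqI\<close> replaces
    the last of them by a variable, which then joins the suffix of variables.\<close>
  have "P (fs @ map X is) = Q (fs @ map X is)" if "length fs + length is = k" for fs "is"
    using that
  proof (induction fs arbitrary: "is" rule: rev_induct)
    case Nil
    then show ?case using eq by simp
  next
    case (snoc f fs)
    let ?gs = "fs @ 0 # map X is"
    have gs: "length ?gs = k" "length fs < k" and upd: "?gs[length fs := g] = fs @ g # map X is" for g
      using snoc.prems by (auto simp: list_update_append)
    have "P (?gs[length fs := f]) = Q (?gs[length fs := f])"
    proof (rule derivation_eqI[OF P[OF gs] Q[OF gs]])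
      fix i
      show "P (?gs[length fs := X i]) = Q (?gs[length fs := X i])"
        unfolding upd using snoc.IH[of "i # is"] snoc.prems by simp
    qed
    then show ?case by (simp add: upd)
  qed
  from this[of fs "[]"] show ?thesis using len by simp
qed

lemma cochain_eqI:
  assumes P: "P \<in> cochains pscale k" and Q: "Q \<in> cochains pscale k"
    and eq: "\<And>is. length is = k \<Longrightarrow> P (map X is) = Q (map X is)"
  shows "P = Q"
proof
  fix fs
  show "P fs = Q fs"
  proof (cases "length fs = k")
    case True
    then show ?thesis
      using cpoly.cochain_derivation[OF P] cpoly.cochain_derivation[OF Q] eq
      by (intro multiderivation_eqI[of k P Q fs]) auto
  qed (simp add: cpoly.cochain_arity[OF P] cpoly.cochain_arity[OF Q])
qed

section \<open>The coboundary of a log-canonical bracket\<close>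

text \<open>Entries count with multiplicity, so the coefficient formula of the coboundary holds for
  every list of variables, and the weight depends only on the multiset of entries.\<close>

definition weight :: "'n list \<Rightarrow> ('n \<Rightarrow>\<^sub>0 nat) \<Rightarrow> 'n \<Rightarrow> int" where
  "weight is \<alpha> i = int (Poly_Mapping.lookup \<alpha> i) - int (count_list is i)"

lemma weight_Cons: "weight (i # is) (\<alpha> + unit_exp i) = weight is \<alpha>"
  by (auto simp: weight_def lookup_add)

text \<open>The coboundary draws its coefficient at \<open>(is, \<alpha>)\<close> from exactly these
  shortened pairs; this is the precise form in which it preserves weights.\<close>

lemma weight_remove:
  assumes "a < length is" "Poly_Mapping.lookup \<alpha> (is ! a) \<noteq> 0"
  shows "weight (nths is (- {a})) (\<alpha> - unit_exp (is ! a)) = weight is \<alpha>"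
proof
  fix j
  show "weight (nths is (- {a})) (\<alpha> - unit_exp (is ! a)) j = weight is \<alpha> j"
    using assms count_list_remove[OF assms(1), of j] by (auto simp: weight_def lookup_minus)
qed

lemma weight_swap:
  "i < j \<Longrightarrow> j < length is \<Longrightarrow> weight (is[i := is ! j, j := is ! i]) = weight is"
  using mset_swap[of j "is" i] by (simp add: weight_def count_mset[symmetric] fun_eq_iff)

definition residue :: "int ^ 'n ^ 'n \<Rightarrow> ('n::finite \<Rightarrow> int) \<Rightarrow> 'n \<Rightarrow> int" where
  "residue A w i = (\<Sum>j\<in>UNIV. A $ i $ j * w j)"

definition resonant :: "int ^ 'n ^ 'n \<Rightarrow> ('n::finite \<Rightarrow> int) \<Rightarrow> bool" where
  "resonant A w \<longleftrightarrow> (\<forall>i. w i < 0 \<or> residue A w i = 0)"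

lemma sum_nth_eq_sum_count:
  fixes f :: "'n::finite \<Rightarrow> int"
  shows "(\<Sum>b<length is. f (is ! b)) = (\<Sum>j\<in>UNIV. f j * int (count_list is j))"
proof (induction "is")
  case (Cons i "is")
  have "(\<Sum>j\<in>UNIV. f j * int (count_list (i # is) j)) =
    (\<Sum>j\<in>UNIV. (if i = j then f j else 0) + f j * int (count_list is j))"
    by (intro sum.cong) (auto simp: algebra_simps)
  with Cons show ?case
    by (simp add: sum.lessThan_Suc_shift sum.distrib del: sum.lessThan_Suc)
qed simp

lemma of_int_mult_eq_pscale: "of_int c * f = pscale (of_int c) f"
  by (simp add: pscale_def mult_map_scale_conv_mult single_of_int)

lemma lookup_of_int_mult [simp]:
  fixes f :: "'n cpoly"
  shows "Poly_Mapping.lookup (of_int c * f) \<alpha> = of_int c * Poly_Mapping.lookup f \<alpha>"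
  by (simp add: of_int_mult_eq_pscale)

lemma lookup_sign_mult [simp]:
  fixes f :: "'n cpoly"
  shows "Poly_Mapping.lookup ((-1) ^ a * f) \<alpha> = (-1) ^ a * Poly_Mapping.lookup f \<alpha>"
  by (cases "even a") auto

lemma inj_X: "inj (X :: 'n \<Rightarrow> 'n cpoly)"
proof
  fix i j :: 'n
  assume "X i = X j"
  then have "partial i (X i) = partial i (X j)" by simp
  then show "i = j" by (simp add: partial_X split: if_splits)
qed

locale log_canonical = poisson_algebra pscale br
  for br :: "'n::{finite,linorder} cpoly \<Rightarrow> 'n cpoly \<Rightarrow> 'n cpoly" +
  fixes A :: "int ^ 'n::{finite,linorder} ^ 'n::{finite,linorder}"
  assumes transpose_A: "transpose A = - A"
    and br_X: "br (X i) (X j) = of_int (A $ i $ j) * X i * X j"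
begin

section \<open>The coboundary on lists of variables\<close>

lemma A_skew: "A $ i $ j = - (A $ j $ i)"
proof -
  have "transpose A $ j $ i = (- A) $ j $ i" by (simp add: transpose_A)
  then show ?thesis by (simp add: transpose_def)
qed

lemma A_diag: "A $ i $ i = 0"
  using A_skew[of i i] by simp

lemma br_X_partial: "br (X i) f = (\<Sum>j\<in>UNIV. of_int (A $ i $ j) * X i * X j * partial j f)"
proof (rule derivation_eqI[OF br_right])
  show "derivation pscale (\<lambda>f. \<Sum>j\<in>UNIV. of_int (A $ i $ j) * X i * X j * partial j f)"
    by (intro derivation_summation derivation_times derivation_partial)
  show "br (X i) (X j) = (\<Sum>j'\<in>UNIV. of_int (A $ i $ j') * X i * X j' * partial j' (X j))" for j
    by (simp add: br_X partial_X if_distrib cong: if_cong)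
qed

lemma lookup_br_X:
  "Poly_Mapping.lookup (br (X i) f) \<alpha> =
    (if Poly_Mapping.lookup \<alpha> i = 0 then 0
     else of_int (\<Sum>j\<in>UNIV. A $ i $ j * int (Poly_Mapping.lookup \<alpha> j)) *
       Poly_Mapping.lookup f (\<alpha> - unit_exp i))"
proof -
  \<comment> \<open>The exponents differ only at \<open>i\<close>, where the diagonal entry of
    \<open>A\<close> is zero.\<close>
  have *: "of_int (A $ i $ j) * of_nat (Poly_Mapping.lookup (\<alpha> - unit_exp i) j) =
    (of_int (A $ i $ j) * of_nat (Poly_Mapping.lookup \<alpha> j) :: complex)" for j
    by (cases "i = j") (auto simp: A_diag lookup_minus)
  have "br (X i) f = (\<Sum>j\<in>UNIV. of_int (A $ i $ j) * (X i * (X j * partial j f)))"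
    by (simp add: br_X_partial mult.assoc)
  then have "Poly_Mapping.lookup (br (X i) f) \<alpha> = (\<Sum>j\<in>UNIV. of_int (A $ i $ j) *
    Poly_Mapping.lookup (X i * (X j * partial j f)) \<alpha>)"
    by (simp add: lookup_sum)
  also have "\<dots> = (if Poly_Mapping.lookup \<alpha> i = 0 then 0 else
    (\<Sum>j\<in>UNIV. of_int (A $ i $ j) * of_nat (Poly_Mapping.lookup (\<alpha> - unit_exp i) j) *
      Poly_Mapping.lookup f (\<alpha> - unit_exp i)))"
    by (simp add: lookup_X_mult[of i] lookup_X_mult_partial mult.assoc)
  also have "\<dots> = (if Poly_Mapping.lookup \<alpha> i = 0 then 0
     else of_int (\<Sum>j\<in>UNIV. A $ i $ j * int (Poly_Mapping.lookup \<alpha> j)) *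
       Poly_Mapping.lookup f (\<alpha> - unit_exp i))"
    unfolding * by (simp add: sum_distrib_right)
  finally show ?thesis .
qed

text \<open>Substituting the bracket a_ij X_i X_j and applying the Leibniz rule leaves two terms.
  One still omits position \<open>a\<close>; in the other, \<open>cochain_remove_update\<close>
  trades the omission of \<open>a\<close> for that of \<open>b\<close>. Skew symmetry of
  \<open>A\<close> makes both total contributions equal, which matches the doubling.\<close>

lemma coboundary_variables:
  assumes P: "P \<in> cochains pscale k" and len: "length is = Suc k"
  shows "coboundary br k P (map X is) =
    (\<Sum>a\<le>k. (-1) ^ a * (br (X (is ! a)) (P (map X (nths is (- {a}))))
       - of_int (\<Sum>b\<le>k. A $ (is ! a) $ (is ! b)) * (X (is ! a) * P (map X (nths is (- {a}))))))"
proof (rule double_inject)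
  define fs where "fs = map X is"
  define Q where "Q a = P (nths fs (- {a}))" for a
  define V where "V a = (-1) ^ a * (X (is ! a) * Q a)" for a
  define c where "c a b = A $ (is ! a) $ (is ! b)" for a b
  have fs: "length fs = Suc k" "\<And>a. a \<le> k \<Longrightarrow> fs ! a = X (is ! a)"
    using len by (auto simp: fs_def)
  have upd: "(-1) ^ a * P (nths (fs[b := br (fs ! a) (fs ! b)]) (- {a})) = of_int (c a b) * (V a - V b)"
    if ab: "a \<le> k" "b \<in> {..k} - {a}" for a b
  proof -
    have D: "derivation pscale (\<lambda>g. P (nths (fs[b := g]) (- {a})))"
      using derivation_cochain_remove[OF P fs(1)] ab by simp
    have "fs[b := X (is ! b)] = fs" "fs[a := X (is ! a)] = fs"
      using fs(2)[of a] fs(2)[of b] ab by (metis DiffD1 atMost_iff list_update_id)+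
    then have Qa: "P (nths (fs[b := X (is ! b)]) (- {a})) = Q a"
      and Qb: "(-1) ^ a * P (nths (fs[b := X (is ! a)]) (- {a})) = - ((-1) ^ b * Q b)"
      using cochain_remove_update[OF P, of a b fs "X (is ! a)"] ab fs(1) by (auto simp: Q_def)
    have "P (nths (fs[b := br (fs ! a) (fs ! b)]) (- {a})) =
      of_int (c a b) * P (nths (fs[b := X (is ! a) * X (is ! b)]) (- {a}))"
      using ab derivation_scale[OF D, of "of_int (c a b)" "X (is ! a) * X (is ! b)"]
      by (simp add: fs br_X of_int_mult_eq_pscale[symmetric] c_def mult.assoc)
    also have "P (nths (fs[b := X (is ! a) * X (is ! b)]) (- {a})) =
      X (is ! a) * Q a + X (is ! b) * P (nths (fs[b := X (is ! a)]) (- {a}))"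
      by (simp add: derivation_mult[OF D] Qa)
    finally have "(-1) ^ a * P (nths (fs[b := br (fs ! a) (fs ! b)]) (- {a})) = of_int (c a b) *
      (V a + X (is ! b) * ((-1) ^ a * P (nths (fs[b := X (is ! a)]) (- {a}))))"
      by (simp add: V_def algebra_simps)
    then show ?thesis
      by (simp add: Qb V_def algebra_simps)
  qed
  have swap: "(\<Sum>a\<le>k. \<Sum>b\<le>k. of_int (c a b) * V b) = - (\<Sum>a\<le>k. \<Sum>b\<le>k. of_int (c a b) * V a)"
  proof -
    have "(\<Sum>a\<le>k. \<Sum>b\<le>k. of_int (c a b) * V b) = (\<Sum>b\<le>k. \<Sum>a\<le>k. of_int (c a b) * V b)"
      by (rule sum.swap)
    also have "\<dots> = (\<Sum>b\<le>k. \<Sum>a\<le>k. - (of_int (c b a) * V b))"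
      using A_skew by (intro sum.cong refl) (metis c_def mult_minus_left of_int_minus)
    finally show ?thesis by (simp add: sum_negf)
  qed
  \<comment> \<open>The index \<open>b = a\<close> may be added, since \<open>V a - V a\<close> is
    zero.\<close>
  have "(\<Sum>b\<in>{..k} - {a}. of_int (c a b) * (V a - V b)) = (\<Sum>b\<le>k. of_int (c a b) * (V a - V b))"
    if "a \<le> k" for a
    using that by (intro sum.mono_neutral_left) auto
  then have pairs: "(\<Sum>a\<le>k. (-1) ^ a * (\<Sum>b\<in>{..k} - {a}. P (nths (fs[b := br (fs ! a) (fs ! b)]) (- {a})))) =
    (\<Sum>a\<le>k. \<Sum>b\<le>k. of_int (c a b) * V a) + (\<Sum>a\<le>k. \<Sum>b\<le>k. of_int (c a b) * V a)"
    using upd swap by (simp add: sum_distrib_left right_diff_distrib sum_subtractf)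
  have "coboundary br k P fs + coboundary br k P fs =
    (\<Sum>a\<le>k. (-1) ^ a * br (X (is ! a)) (Q a)) + (\<Sum>a\<le>k. (-1) ^ a * br (X (is ! a)) (Q a))
    - (\<Sum>a\<le>k. (-1) ^ a * (\<Sum>b\<in>{..k} - {a}. P (nths (fs[b := br (fs ! a) (fs ! b)]) (- {a}))))"
    unfolding coboundary_double[OF P fs(1)] sum.distrib[symmetric] sum_subtractf[symmetric]
    by (intro sum.cong refl) (simp add: fs(2) Q_def algebra_simps)
  also have "\<dots> = (\<Sum>a\<le>k. (-1) ^ a * br (X (is ! a)) (Q a) - (\<Sum>b\<le>k. of_int (c a b) * V a))
    + (\<Sum>a\<le>k. (-1) ^ a * br (X (is ! a)) (Q a) - (\<Sum>b\<le>k. of_int (c a b) * V a))"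
    unfolding pairs by (simp add: sum_subtractf)
  also have "(\<Sum>a\<le>k. (-1) ^ a * br (X (is ! a)) (Q a) - (\<Sum>b\<le>k. of_int (c a b) * V a)) =
    (\<Sum>a\<le>k. (-1) ^ a * (br (X (is ! a)) (P (map X (nths is (- {a}))))
       - of_int (\<Sum>b\<le>k. A $ (is ! a) $ (is ! b)) * (X (is ! a) * P (map X (nths is (- {a}))))))"
    by (intro sum.cong refl)
      (simp add: V_def Q_def c_def fs_def map_nths sum_distrib_left sum_distrib_right algebra_simps)
  finally show "coboundary br k P (map X is) + coboundary br k P (map X is) =
    (\<Sum>a\<le>k. (-1) ^ a * (br (X (is ! a)) (P (map X (nths is (- {a}))))
       - of_int (\<Sum>b\<le>k. A $ (is ! a) $ (is ! b)) * (X (is ! a) * P (map X (nths is (- {a}))))))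
    + (\<Sum>a\<le>k. (-1) ^ a * (br (X (is ! a)) (P (map X (nths is (- {a}))))
       - of_int (\<Sum>b\<le>k. A $ (is ! a) $ (is ! b)) * (X (is ! a) * P (map X (nths is (- {a}))))))"
    by (simp add: fs_def)
qed

text \<open>In terms of the coefficients of a fixed weight, the coboundary is the exterior product with
  the residue vector of that weight.\<close>

lemma lookup_coboundary_variables:
  assumes P: "P \<in> cochains pscale k" and len: "length is = Suc k"
  shows "Poly_Mapping.lookup (coboundary br k P (map X is)) \<alpha> =
    (\<Sum>a\<le>k. (-1) ^ a * (if Poly_Mapping.lookup \<alpha> (is ! a) = 0 then 0 else
       of_int (residue A (weight is \<alpha>) (is ! a)) *
       Poly_Mapping.lookup (P (map X (nths is (- {a})))) (\<alpha> - unit_exp (is ! a))))"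
proof -
  have res: "residue A (weight is \<alpha>) i =
    (\<Sum>j\<in>UNIV. A $ i $ j * int (Poly_Mapping.lookup \<alpha> j)) - (\<Sum>b\<le>k. A $ i $ (is ! b))" for i
    using sum_nth_eq_sum_count[of "\<lambda>j. A $ i $ j" "is"] len
    by (simp add: residue_def weight_def right_diff_distrib sum_subtractf lessThan_Suc_atMost)
  show ?thesis
    unfolding coboundary_variables[OF P len] lookup_sum lookup_sign_mult lookup_minus lookup_br_X
      lookup_of_int_mult lookup_X_mult
    by (intro sum.cong refl) (simp add: res left_diff_distrib)
qed

text \<open>Removing any position other than the two equal ones leaves a repetition, on which
  \<open>P\<close> vanishes. The two remaining terms share the variable, hence the residue and the
  shifted exponent, and have opposite signs.\<close>

lemma coboundary_variables_not_distinct: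
  assumes P: "P \<in> cochains pscale k" and len: "length is = Suc k" and nd: "\<not> distinct is"
  shows "coboundary br k P (map X is) = 0"
proof (rule poly_mapping_eqI)
  fix \<alpha>
  obtain c d where cd: "c < d" "d \<le> k" "is ! c = is ! d"
    using nd len by (auto simp: distinct_conv_nth) (metis less_Suc_eq_le linorder_neqE_nat)
  let ?Q = "\<lambda>a. P (map X (nths is (- {a})))"
  let ?t = "\<lambda>a. (-1) ^ a * (if Poly_Mapping.lookup \<alpha> (is ! a) = 0 then 0 else
       of_int (residue A (weight is \<alpha>) (is ! a)) *
       Poly_Mapping.lookup (?Q a) (\<alpha> - unit_exp (is ! a)))"
  have "?Q a = 0" if a: "a \<le> k" "a \<noteq> c" "a \<noteq> d" for a
  proof -
    obtain us x vs where s: "is = us @ x # vs" "length us = a"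
      using list_split1[of a "is"] a len by auto
    have "\<not> distinct (us @ vs)"
    proof
      assume dist: "distinct (us @ vs)"
      \<comment> \<open>The positions of the two equal entries after the removal of
        \<open>a\<close>.\<close>
      define c' d' where "c' = (if c < a then c else c - 1)" and "d' = (if d < a then d else d - 1)"
      have "c' < length (us @ vs)" "d' < length (us @ vs)" "c' \<noteq> d'"
        "(us @ vs) ! c' = (us @ vs) ! d'"
        using s len a cd by (auto simp: c'_def d'_def nth_append nth_Cons')
      with dist show False by (simp add: nth_eq_iff_index_eq)
    qed
    then have "\<not> distinct (map X (us @ vs) :: 'n cpoly list)"
      using inj_on_subset[OF inj_X subset_UNIV] by (simp add: distinct_map del: distinct_append map_append)
    then show ?thesis
      using cochain_not_distinct[OF P] nths_remove_middle[of us x vs] s by simp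
  qed
  then have "(\<Sum>a\<le>k. ?t a) = (\<Sum>a\<in>{c, d}. ?t a)"
    using cd by (intro sum.mono_neutral_right) auto
  also have "\<dots> = ?t c + ?t d" using cd by simp
  also have "\<dots> = 0"
  proof -
    let ?f = "map X is :: 'n cpoly list"
    have "?f[c := X (is ! c)] = ?f" "?f[d := X (is ! c)] = ?f"
      using cd len by (simp_all add: list_update_same_conv)
    then have "(-1) ^ c * ?Q c = - ((-1) ^ d * ?Q d)"
      using cochain_remove_update[OF P, of c d ?f "X (is ! c)"] cd len by (simp add: map_nths)
    then have "(-1) ^ c * Poly_Mapping.lookup (?Q c) \<beta> = - ((-1) ^ d * Poly_Mapping.lookup (?Q d) \<beta>)" for \<beta>
      by (metis lookup_sign_mult lookup_uminus)
    from this[of "\<alpha> - unit_exp (is ! c)"] show ?thesis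
      using cd(3) by (auto simp: mult.left_commute[of "(-1) ^ _"] simp flip: distrib_left)
  qed
  finally show "Poly_Mapping.lookup (coboundary br k P (map X is)) \<alpha> = Poly_Mapping.lookup 0 \<alpha>"
    using lookup_coboundary_variables[OF P len, of \<alpha>] by simp
qed

text \<open>An entry of a distinct list is counted once. If the weight there is negative, the
  exponent is zero and the term is absent; otherwise the residue vanishes. As \<open>P\<close> is
  arbitrary, coboundaries carry no resonant coefficients on distinct lists.\<close>

lemma lookup_coboundary_resonant:
  assumes P: "P \<in> cochains pscale k" and len: "length is = Suc k" and "distinct is"
    and res: "resonant A (weight is \<alpha>)"
  shows "Poly_Mapping.lookup (coboundary br k P (map X is)) \<alpha> = 0"
  unfolding lookup_coboundary_variables[OF P len]
proof (rule sum.neutral, rule ballI)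
  fix a assume "a \<in> {..k}"
  then have "count_list is (is ! a) = 1"
    using \<open>distinct is\<close> len by (simp add: distinct_count_atmost_1 count_mset)
  then have "Poly_Mapping.lookup \<alpha> (is ! a) = 0 \<or> residue A (weight is \<alpha>) (is ! a) = 0"
    using res by (force simp: resonant_def weight_def)
  then show "(-1) ^ a * (if Poly_Mapping.lookup \<alpha> (is ! a) = 0 then 0 else
       of_int (residue A (weight is \<alpha>) (is ! a)) *
       Poly_Mapping.lookup (P (map X (nths is (- {a})))) (\<alpha> - unit_exp (is ! a))) = 0"
    by auto
qed

text \<open>At a non-resonant weight the coboundary combines coefficients of \<open>P\<close> of
  that same weight, which are zero; at a resonant weight \<open>lookup_coboundary_resonant\<close>
  applies. This supplies the cocycles that realise the monomial forms.\<close>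

lemma coboundary_of_resonant:
  assumes P: "P \<in> cochains pscale k"
    and res: "\<And>is \<alpha>. length is = k \<Longrightarrow> Poly_Mapping.lookup (P (map X is)) \<alpha> \<noteq> 0 \<Longrightarrow> resonant A (weight is \<alpha>)"
  shows "coboundary br k P = 0"
proof
  fix fs :: "'n cpoly list"
  have "coboundary br k P (map X is) = 0" if len: "length is = Suc k" for "is"
  proof (cases "distinct is")
    case True
    show ?thesis
    proof (rule poly_mapping_eqI)
      fix \<alpha>
      have "Poly_Mapping.lookup (coboundary br k P (map X is)) \<alpha> = 0"
      proof (cases "resonant A (weight is \<alpha>)")
        case False
        have "Poly_Mapping.lookup (P (map X (nths is (- {a})))) (\<alpha> - unit_exp (is ! a)) = 0"
          if "a \<le> k" "Poly_Mapping.lookup \<alpha> (is ! a) \<noteq> 0" for a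
          using res[of "nths is (- {a})" "\<alpha> - unit_exp (is ! a)"] weight_remove[of a "is" \<alpha>] False that len
          by (auto simp: length_nths_remove)
        then show ?thesis
          unfolding lookup_coboundary_variables[OF P len] by (intro sum.neutral) auto
      qed (use lookup_coboundary_resonant[OF P len True] in auto)
      then show "Poly_Mapping.lookup (coboundary br k P (map X is)) \<alpha> = Poly_Mapping.lookup 0 \<alpha>" by simp
    qed
  qed (rule coboundary_variables_not_distinct[OF P len])
  then show "coboundary br k P fs = 0 fs"
  proof (cases "length fs = Suc k")
    case True
    then show ?thesis
      using \<open>\<And>is. length is = Suc k \<Longrightarrow> coboundary br k P (map X is) = 0\<close> derivation_coboundary[OF P]
      by (intro multiderivation_eqI[of "Suc k" "coboundary br k P" 0 fs])
        (auto simp: zero_fun_def derivation_zero)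
  qed (simp add: coboundary_def)
qed

text \<open>The index is chosen from the weight alone, so all terms of a coboundary at a given
  coefficient are contracted with the same coordinate.\<close>

definition nonresonant_index :: "('n \<Rightarrow> int) \<Rightarrow> 'n" where
  "nonresonant_index w = (SOME i. w i \<ge> 0 \<and> residue A w i \<noteq> 0)"

lemma nonresonant_index:
  assumes "\<not> resonant A w"
  shows "w (nonresonant_index w) \<ge> 0" "residue A w (nonresonant_index w) \<noteq> 0"
proof -
  have "\<exists>i. w i \<ge> 0 \<and> residue A w i \<noteq> 0"
    using assms by (auto simp: resonant_def not_less)
  from someI_ex[OF this] show "w (nonresonant_index w) \<ge> 0" "residue A w (nonresonant_index w) \<noteq> 0"
    by (auto simp: nonresonant_index_def)
qed

text \<open>Contraction with the coordinate \<open>i\<close>, divided by the \<open>i\<close>-th residue, is a contracting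
  homotopy on a non-resonant weight. The condition \<open>w i \<ge> 0\<close> on the index \<open>i\<close> keeps the result
  polynomial.\<close>

definition contraction :: "('n cpoly list \<Rightarrow> 'n cpoly) \<Rightarrow> 'n list \<Rightarrow> 'n cpoly" where
  "contraction P is = Abs_poly_mapping (\<lambda>\<alpha>.
     if resonant A (weight is \<alpha>) then 0
     else let i = nonresonant_index (weight is \<alpha>) in
       Poly_Mapping.lookup (P (map X (i # is))) (\<alpha> + unit_exp i) / of_int (residue A (weight is \<alpha>) i))"

lemma lookup_contraction:
  "Poly_Mapping.lookup (contraction P is) \<alpha> =
     (if resonant A (weight is \<alpha>) then 0
      else let i = nonresonant_index (weight is \<alpha>) in
        Poly_Mapping.lookup (P (map X (i # is))) (\<alpha> + unit_exp i) / of_int (residue A (weight is \<alpha>) i))"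
  unfolding contraction_def
proof (subst lookup_Abs_poly_mapping)
  \<comment> \<open>The contracted index varies with \<open>\<alpha>\<close>, so the support is
    bounded by the union over all indices.\<close>
  have "finite (\<Union>i\<in>UNIV. {\<alpha>. Poly_Mapping.lookup (P (map X (i # is))) (\<alpha> + unit_exp i) \<noteq> 0})"
    by (intro finite_UN_I finite_shifted_support) simp
  then show "finite {\<alpha>. (if resonant A (weight is \<alpha>) then 0
      else let i = nonresonant_index (weight is \<alpha>) in
        Poly_Mapping.lookup (P (map X (i # is))) (\<alpha> + unit_exp i) / of_int (residue A (weight is \<alpha>) i)) \<noteq> 0}"
    by (rule finite_subset[rotated]) (auto simp: Let_def split: if_splits)
qed simp

lemma skew_contraction:
  assumes P: "P \<in> cochains pscale (Suc k)"
  shows "skew_on_lists k (contraction P)"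
  unfolding skew_on_lists_def
proof (intro allI impI poly_mapping_eqI)
  fix "is" :: "'n list" and i j \<alpha>
  assume A: "length is = k" "i < j" "j < k"
  have "P (map X (l # is[i := is ! j, j := is ! i])) = - P (map X (l # is))" for l
    using cochain_swap[OF P, of "map X (l # is)" "Suc i" "Suc j"] A by (simp add: map_update)
  then show "Poly_Mapping.lookup (contraction P (is[i := is ! j, j := is ! i])) \<alpha> =
    Poly_Mapping.lookup (- contraction P is) \<alpha>"
    using A by (simp add: lookup_contraction weight_swap Let_def del: list.map)
qed

text \<open>This is the homotopy identity for a cocycle, with the coboundary of the contraction
  written out. Evaluate the vanishing coboundary on \<open>i # is\<close> at
  \<open>\<alpha> + unit_exp i\<close>: removing the new entry gives the residue of \<open>i\<close>
  times the coefficient sought, and the other terms give the right-hand side.\<close>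

lemma lookup_cocycle_nonresonant:
  assumes P: "P \<in> cocycles pscale br k" and len: "length is = k" and nr: "\<not> resonant A (weight is \<alpha>)"
  defines "i \<equiv> nonresonant_index (weight is \<alpha>)"
  shows "Poly_Mapping.lookup (P (map X is)) \<alpha> =
    (\<Sum>a<k. (-1) ^ a * (if Poly_Mapping.lookup \<alpha> (is ! a) = 0 then 0 else
       of_int (residue A (weight is \<alpha>) (is ! a)) *
       (Poly_Mapping.lookup (P (map X (i # nths is (- {a})))) (\<alpha> - unit_exp (is ! a) + unit_exp i) /
        of_int (residue A (weight is \<alpha>) i))))"
proof -
  let ?u = "residue A (weight is \<alpha>)"
  let ?t = "\<lambda>a. if Poly_Mapping.lookup \<alpha> (is ! a) = 0 then 0 else of_int (?u (is ! a)) *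
       Poly_Mapping.lookup (P (map X (i # nths is (- {a})))) (\<alpha> - unit_exp (is ! a) + unit_exp i)"
  have Pc: "P \<in> cochains pscale k" and d: "coboundary br k P = 0"
    using P by (auto simp: cocycles_def)
  have i: "weight is \<alpha> i \<ge> 0" "?u i \<noteq> 0"
    using nonresonant_index[OF nr] by (simp_all add: i_def)
  have "0 = Poly_Mapping.lookup (coboundary br k P (map X (i # is))) (\<alpha> + unit_exp i)"
    by (simp add: d)
  also have "\<dots> = of_int (?u i) * Poly_Mapping.lookup (P (map X is)) \<alpha> - (\<Sum>a<k. (-1) ^ a * ?t a)"
  proof -
    have t: "(if Poly_Mapping.lookup (\<alpha> + unit_exp i) (is ! a) = 0 then 0 else
       of_int (?u (is ! a)) * Poly_Mapping.lookup (P (map X (i # nths is (- {a}))))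
         (\<alpha> + unit_exp i - unit_exp (is ! a))) = ?t a" if a: "a < k" for a
    proof -
      \<comment> \<open>Only \<open>is ! a = i\<close> is in doubt. Then \<open>i\<close> occurs in
        \<open>is\<close>, and its nonnegative weight forces a positive exponent even before
        \<open>unit_exp i\<close> is added.\<close>
      have "Poly_Mapping.lookup (\<alpha> + unit_exp i) (is ! a) = 0 \<longleftrightarrow> Poly_Mapping.lookup \<alpha> (is ! a) = 0"
      proof (cases "is ! a = i")
        case True
        then have "count_list is i \<noteq> 0"
          using a len nth_mem[of a "is"] by (simp add: count_list_0_iff)
        then show ?thesis using i True by (auto simp: weight_def lookup_add)
      qed (simp add: lookup_add)
      moreover have "\<alpha> + unit_exp i - unit_exp (is ! a) = \<alpha> - unit_exp (is ! a) + unit_exp i"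
        if "Poly_Mapping.lookup \<alpha> (is ! a) \<noteq> 0"
        using that by (intro poly_mapping_eqI) (auto simp: lookup_add lookup_minus)
      ultimately show ?thesis by auto
    qed
    have rem: "nths (i # is) (- {0}) = is" "nths (i # is) (- {Suc a}) = i # nths is (- {a})" for a
      using nths_remove_middle[of "[]" i "is"]
      by (auto simp: nths_Cons intro!: arg_cong2[of _ _ _ _ nths])
    have len': "length (i # is) = Suc k" using len by simp
    have "(\<Sum>a<k. (-1) ^ Suc a * (if Poly_Mapping.lookup (\<alpha> + unit_exp i) (is ! a) = 0 then 0 else
       of_int (?u (is ! a)) * Poly_Mapping.lookup (P (map X (i # nths is (- {a}))))
         (\<alpha> + unit_exp i - unit_exp (is ! a)))) = (\<Sum>a<k. - ((-1) ^ a * ?t a))"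
      by (rule sum.cong[OF refl]) (simp only: t lessThan_iff power_Suc mult_minus_left mult_1_left)
    then show ?thesis
      unfolding lookup_coboundary_variables[OF Pc len'] sum.atMost_shift nth_Cons_0 nth_Cons_Suc
        rem weight_Cons
      by (simp only: sum_negf) (simp add: lookup_add)
  qed
  finally have "Poly_Mapping.lookup (P (map X is)) \<alpha> = (\<Sum>a<k. (-1) ^ a * ?t a) / of_int (?u i)"
    using i by (simp add: field_simps)
  then show ?thesis
    by (simp add: sum_divide_distrib) (intro sum.cong refl, simp)
qed

text \<open>The primitive is the cochain extending \<open>contraction P\<close>. It reproduces the
  non-resonant coefficients by \<open>lookup_cocycle_nonresonant\<close>; the resonant ones are zero
  on both sides.\<close>

lemma cocycle_is_coboundary:
  assumes P: "P \<in> cocycles pscale br k"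
    and zero: "\<And>is \<alpha>. length is = k \<Longrightarrow> resonant A (weight is \<alpha>) \<Longrightarrow> Poly_Mapping.lookup (P (map X is)) \<alpha> = 0"
  shows "P \<in> coboundaries pscale br k"
proof (cases k)
  case 0
  have Pc: "P \<in> cochains pscale k" using P by (simp add: cocycles_def)
  have eq: "P (map X is) = 0" if len: "length is = k" for "is"
  proof (rule poly_mapping_eqI)
    fix \<alpha>
    show "Poly_Mapping.lookup (P (map X is)) \<alpha> = Poly_Mapping.lookup 0 \<alpha>"
    proof (cases "resonant A (weight is \<alpha>)")
      case True
      then show ?thesis using zero[OF len] by simp
    next
      case False
      \<comment> \<open>For \<open>k = 0\<close> the sum over \<open>a < k\<close> is empty.\<close>
      then show ?thesis using lookup_cocycle_nonresonant[OF P len] 0 by simp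
    qed
  qed
  have "(0 :: 'n cpoly list \<Rightarrow> 'n cpoly) \<in> cochains pscale k"
    by (auto simp: cochains_def intro: derivation_zero)
  then have "P = 0"
    by (rule cochain_eqI[OF Pc]) (simp add: eq)
  with 0 show ?thesis by simp
next
  case (Suc l)
  define Q where "Q = cochain_of l (contraction P)"
  have Pc: "P \<in> cochains pscale (Suc l)" using P Suc by (simp add: cocycles_def)
  then have Qc: "Q \<in> cochains pscale l"
    unfolding Q_def by (intro cochain_of_in_cochains skew_contraction)
  have eq: "P (map X is) = coboundary br l Q (map X is)" if len: "length is = Suc l" for "is"
  proof (rule poly_mapping_eqI)
    fix \<alpha>
    have Q: "Poly_Mapping.lookup (Q (map X (nths is (- {a})))) (\<alpha> - unit_exp (is ! a)) =
      (if resonant A (weight is \<alpha>) then 0 else let i = nonresonant_index (weight is \<alpha>) in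
        Poly_Mapping.lookup (P (map X (i # nths is (- {a})))) (\<alpha> - unit_exp (is ! a) + unit_exp i) /
          of_int (residue A (weight is \<alpha>) i))"
      if "a \<le> l" "Poly_Mapping.lookup \<alpha> (is ! a) \<noteq> 0" for a
    proof -
      have "Q (map X (nths is (- {a}))) = contraction P (nths is (- {a}))"
        unfolding Q_def using that len by (intro cochain_of_variables) (simp add: length_nths_remove)
      moreover have "weight (nths is (- {a})) (\<alpha> - unit_exp (is ! a)) = weight is \<alpha>"
        using that len by (intro weight_remove) auto
      ultimately show ?thesis by (simp only: lookup_contraction)
    qed
    show "Poly_Mapping.lookup (P (map X is)) \<alpha> = Poly_Mapping.lookup (coboundary br l Q (map X is)) \<alpha>"
    proof (cases "resonant A (weight is \<alpha>)")
      case True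
      then have "Poly_Mapping.lookup (coboundary br l Q (map X is)) \<alpha> = 0"
        unfolding lookup_coboundary_variables[OF Qc len] by (intro sum.neutral ballI) (simp add: Q)
      then show ?thesis
        using zero[of "is" \<alpha>] len Suc True by simp
    next
      case False
      have len': "length is = k" using len Suc by simp
      show ?thesis
        unfolding lookup_coboundary_variables[OF Qc len] lookup_cocycle_nonresonant[OF P len' False]
          Suc lessThan_Suc_atMost
        by (rule sum.cong[OF refl]) (simp add: Q False Let_def del: list.map)
    qed
  qed
  have "P fs = coboundary br l Q fs" for fs
  proof (cases "length fs = Suc l")
    case True
    show ?thesis
    proof (rule multiderivation_eqI[where k = "Suc l"])
      show "derivation pscale (\<lambda>g. P (fs[i := g]))" if "length fs = Suc l" "i < Suc l" for fs i
        using cochain_derivation[OF Pc that] .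
      show "derivation pscale (\<lambda>g. coboundary br l Q (fs[i := g]))" if "length fs = Suc l" "i < Suc l" for fs i
        using derivation_coboundary[OF Qc] that by simp
    qed (fact eq True)+
  qed (simp add: cochain_arity[OF Pc] coboundary_def)
  then have "P = coboundary br l Q" by blast
  with Suc Qc show ?thesis by simp
qed

lemma lookup_coboundaries_resonant:
  assumes "P \<in> coboundaries pscale br k" "length is = k" "distinct is" "resonant A (weight is \<alpha>)"
  shows "Poly_Mapping.lookup (P (map X is)) \<alpha> = 0"
proof (cases k)
  case 0
  with assms(1) show ?thesis by simp
next
  case (Suc l)
  then obtain Q where "Q \<in> cochains pscale l" "P = coboundary br l Q"
    using assms(1) by auto
  then show ?thesis
    using lookup_coboundary_resonant[of Q l "is" \<alpha>] assms Suc by simp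
qed

end

section \<open>The associated differential forms\<close>

text \<open>Under \<open>cochain_of\<close> this becomes the determinant of partial derivatives
  along \<open>js\<close>, that is, the exterior product of the corresponding d/dX_j. It serves
  twice: to separate the forms dX_J and to build cocycles.\<close>

definition alternating_indicator :: "'n list \<Rightarrow> 'n list \<Rightarrow> 'n cpoly" where
  "alternating_indicator js is =
     (\<Sum>p | p permutes {..<length js}. of_int (sign p) * (if is = permute_list p js then 1 else 0))"

lemma skew_alternating_indicator:
  fixes js :: "'n list"
  shows "skew_on_lists (length js) (alternating_indicator js)"
  unfolding skew_on_lists_def
proof (intro allI impI)
  fix "is" :: "'n list" and i j
  assume A: "length is = length js" "i < j" "j < length js"
  let ?t = "Transposition.transpose i j" and ?S = "{..<length js}"
  have t: "?t permutes ?S" using A by (intro permutes_swap_id) auto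
  have swap: "xs[i := xs ! j, j := xs ! i] = permute_list ?t xs" if "length xs = length js" for xs :: "'n list"
    using that A
    by (intro nth_equalityI) (auto simp: permute_list_def Transposition.transpose_def nth_list_update)
  have inv: "permute_list ?t (permute_list ?t xs) = xs" if "length xs = length js" for xs :: "'n list"
    using permute_list_compose[of ?t xs ?t] that t by simp
  \<comment> \<open>Composing every \<open>p\<close> with the transposition absorbs the swap of
    \<open>is\<close> and reverses all signs.\<close>
  have "alternating_indicator js (permute_list ?t is) =
    (\<Sum>p | p permutes ?S. of_int (sign (p \<circ> ?t)) * (if permute_list ?t is = permute_list (p \<circ> ?t) js then 1 else 0))"
    unfolding alternating_indicator_def by (rule sum_permutations_compose_right[OF t])
  also have "\<dots> = (\<Sum>p | p permutes ?S. - (of_int (sign p) * (if is = permute_list p js then 1 else 0)))"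
  proof (rule sum.cong[OF refl])
    fix p assume "p \<in> {p. p permutes ?S}"
    then have p: "p permutes ?S" by simp
    have "sign (p \<circ> ?t) = - sign p"
      using sign_compose[of p ?t] permutation_permutes[of p] p A
      by (metis finite_lessThan mult_minus1_right nat_neq_iff permutation_swap_id sign_swap_id)
    moreover have "permute_list ?t is = permute_list (p \<circ> ?t) js \<longleftrightarrow> is = permute_list p js"
      using permute_list_compose[OF t, of p] inv[of "is"] inv[of "permute_list p js"] A by (metis length_permute_list)
    ultimately show "of_int (sign (p \<circ> ?t)) * (if permute_list ?t is = permute_list (p \<circ> ?t) js then 1 else 0) =
      - (of_int (sign p) * (if is = permute_list p js then 1 else 0 :: 'n cpoly))"
      by simp
  qed
  finally show "alternating_indicator js (is[i := is ! j, j := is ! i]) = - alternating_indicator js is"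
    using swap[OF A(1)] by (simp add: sum_negf alternating_indicator_def)
qed

lemma alternating_indicator_self:
  assumes "distinct js"
  shows "alternating_indicator js js = 1"
proof -
  have "js = permute_list p js \<longleftrightarrow> p = id" if p: "p permutes {..<length js}" for p
  proof
    assume eq: "js = permute_list p js"
    show "p = id"
    proof
      fix i
      show "p i = id i"
      proof (cases "i < length js")
        case True
        then have "js ! i = js ! p i" "p i < length js"
          using permute_list_nth[OF p True] eq permutes_in_image[OF p] by (auto simp del: permute_list_nth)
        then show ?thesis using assms True by (simp add: nth_eq_iff_index_eq)
      qed (use permutes_not_in[OF p] in auto)
    qed
  qed simp
  then have "alternating_indicator js js =
    (\<Sum>p | p permutes {..<length js}. if id = p then of_int (sign p) else 0)"
    unfolding alternating_indicator_def by (intro sum.cong) auto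
  then show ?thesis
    by (simp add: finite_permutations permutes_id)
qed

lemma alternating_indicator_nonzero:
  "alternating_indicator js is \<noteq> 0 \<Longrightarrow> mset is = mset js"
proof (rule ccontr)
  assume nz: "alternating_indicator js is \<noteq> 0" and "mset is \<noteq> mset js"
  then have "is \<noteq> permute_list p js" if "p permutes {..<length js}" for p
    using mset_permute_list[OF that] by auto
  then show False
    using nz by (simp add: alternating_indicator_def)
qed

section \<open>Pairing cochains with forms\<close>

lemma lookup_map_mult [simp]:
  "Poly_Mapping.lookup (Poly_Mapping.map ((*) r) F) fs = r * (Poly_Mapping.lookup F fs :: 'r::comm_ring_1)"
  by (simp add: map.rep_eq when_def)

lemma module_free_form: "module (\<lambda>r. Poly_Mapping.map ((*) (r :: 'r::comm_ring_1)) :: 'r free_form \<Rightarrow> 'r free_form)"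
  by unfold_locales (auto intro!: poly_mapping_eqI simp: lookup_add algebra_simps)

definition form_pairing :: "('r list \<Rightarrow> 'r) \<Rightarrow> 'r::comm_ring_1 free_form \<Rightarrow> 'r" where
  "form_pairing P F = (\<Sum>fs\<in>Poly_Mapping.keys F. Poly_Mapping.lookup F fs * P fs)"

lemma form_pairing_form: "form_pairing P (form g fs) = g * P fs"
  by (simp add: form_pairing_def form_def)

lemma form_pairing_superset:
  assumes "finite S" "Poly_Mapping.keys F \<subseteq> S"
  shows "form_pairing P F = (\<Sum>fs\<in>S. Poly_Mapping.lookup F fs * P fs)"
  unfolding form_pairing_def using assms by (intro sum.mono_neutral_left) (auto simp: in_keys_iff)

lemma form_pairing_add: "form_pairing P (F + G) = form_pairing P F + form_pairing P G"
proof -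
  let ?S = "Poly_Mapping.keys F \<union> Poly_Mapping.keys G"
  show ?thesis
    using form_pairing_superset[of ?S F P] form_pairing_superset[of ?S G P]
      form_pairing_superset[of ?S "F + G" P] Poly_Mapping.keys_add[of F G]
    by (simp add: lookup_add distrib_right sum.distrib)
qed

lemma form_pairing_scale: "form_pairing P (Poly_Mapping.map ((*) r) F) = r * form_pairing P F"
proof -
  have "Poly_Mapping.keys (Poly_Mapping.map ((*) r) F) \<subseteq> Poly_Mapping.keys F"
    by (auto simp: in_keys_iff)
  then show ?thesis
    using form_pairing_superset[of "Poly_Mapping.keys F" "Poly_Mapping.map ((*) r) F" P]
      form_pairing_superset[of "Poly_Mapping.keys F" F P]
    by (simp add: sum_distrib_left mult.assoc)
qed

lemma form_pairing_diff: "form_pairing P (F - G) = form_pairing P F - form_pairing P G"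
  using form_pairing_add[of P "F - G" G] by (simp add: algebra_simps)

context complex_algebra
begin

text \<open>The four kinds of generators express what every cochain satisfies: additivity,
  homogeneity, the Leibniz rule and vanishing on repetitions. On lists of another length the cochain
  is zero. So cochains detect forms that are not relations.\<close>

lemma form_pairing_relations:
  assumes P: "P \<in> cochains sc k" and F: "F \<in> form_relations sc"
  shows "form_pairing P F = 0"
proof -
  interpret M: module "\<lambda>r. Poly_Mapping.map ((*) (r :: 'r)) :: 'r free_form \<Rightarrow> 'r free_form"
    by (rule module_free_form)
  have gen: "form_pairing P G = 0" if "G \<in> form_generators sc" for G
    using that
  proof cases
    case (add us f g vs)
    show ?thesis
    proof (cases "length us + length vs + 1 = k")
      case True
      show ?thesis
        using derivation_add[OF cochain_derivation_middle[OF P True]]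
        by (simp add: add form_pairing_diff form_pairing_form)
    qed (simp add: add form_pairing_diff form_pairing_form cochain_arity[OF P])
  next
    case (scale us c f vs)
    show ?thesis
    proof (cases "length us + length vs + 1 = k")
      case True
      show ?thesis
        using derivation_scale[OF cochain_derivation_middle[OF P True]]
        by (simp add: scale form_pairing_diff form_pairing_form scale_mult_left[symmetric])
    qed (simp add: scale form_pairing_diff form_pairing_form cochain_arity[OF P])
  next
    case (leibniz us f g vs)
    show ?thesis
    proof (cases "length us + length vs + 1 = k")
      case True
      show ?thesis
        using derivation_mult[OF cochain_derivation_middle[OF P True]]
        by (simp add: leibniz form_pairing_diff form_pairing_form)
    qed (simp add: leibniz form_pairing_diff form_pairing_form cochain_arity[OF P])
  next
    case (alternating fs)
    then show ?thesis
      by (simp add: form_pairing_form cochain_not_distinct[OF P])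
  qed
  have "M.subspace {F. form_pairing P F = 0}"
    by (rule M.subspaceI)
      (auto simp: form_pairing_add form_pairing_scale, simp add: form_pairing_def)
  with gen have "M.span (form_generators sc) \<subseteq> {F. form_pairing P F = 0}"
    by (intro M.span_minimal) auto
  with F show ?thesis by (auto simp: form_relations_def)
qed

end

lemma lookup_form_scale [simp]:
  "Poly_Mapping.lookup (form_scale pscale c F) fs = pscale c (Poly_Mapping.lookup F fs)"
  by (simp add: form_scale_def map.rep_eq when_def)

lemma vector_space_form_scale: "vector_space (form_scale (pscale :: complex \<Rightarrow> 'n cpoly \<Rightarrow> 'n cpoly))"
  by unfold_locales
    (auto intro!: poly_mapping_eqI simp: lookup_add cpoly.scale_right_distrib cpoly.scale_left_distrib)

lemma subspace_form_relations:
  "module.subspace (form_scale pscale) (form_relations (pscale :: complex \<Rightarrow> 'n cpoly \<Rightarrow> 'n cpoly))"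
proof -
  interpret M: module "\<lambda>r. Poly_Mapping.map ((*) r) :: 'n cpoly free_form \<Rightarrow> 'n cpoly free_form"
    by (rule module_free_form)
  interpret V: vector_space "form_scale (pscale :: complex \<Rightarrow> 'n cpoly \<Rightarrow> 'n cpoly)"
    by (rule vector_space_form_scale)
  \<comment> \<open>Complex scaling is multiplication by a constant polynomial, so the submodule of
    relations is also a complex subspace.\<close>
  have "form_scale pscale c F = Poly_Mapping.map ((*) (pscale c 1)) F" for c and F :: "'n cpoly free_form"
    by (rule poly_mapping_eqI) (simp add: mult_pscale)
  then show ?thesis
    unfolding form_relations_def by (intro V.subspaceI) (auto intro: M.span_zero M.span_add M.span_scale)
qed

abbreviation increasing :: "'n::{finite,linorder} set \<Rightarrow> 'n list" where
  "increasing I \<equiv> sorted_list_of_set I"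

lemma mset_increasing_eq_iff:
  "distinct is \<Longrightarrow> mset is = mset (increasing I) \<longleftrightarrow> set is = I"
  by (metis distinct_sorted_list_of_set finite set_eq_iff_mset_eq_distinct set_sorted_list_of_set)

lemma card_Compl_add: "card (- I) + card I = CARD('n)" for I :: "'n::finite set"
  using card_Un_disjoint[of "- I" I] by simp

lemma form_eq_sum_monomials:
  "form f fs = (\<Sum>\<alpha>\<in>Poly_Mapping.keys f. form_scale pscale (Poly_Mapping.lookup f \<alpha>) (form (X_pow \<alpha>) fs))"
proof (intro poly_mapping_eqI)
  fix gs \<beta>
  show "Poly_Mapping.lookup (Poly_Mapping.lookup (form f fs) gs) \<beta> =
    Poly_Mapping.lookup (Poly_Mapping.lookup (\<Sum>\<alpha>\<in>Poly_Mapping.keys f.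
      form_scale pscale (Poly_Mapping.lookup f \<alpha>) (form (X_pow \<alpha>) fs)) gs) \<beta>"
    by (cases "fs = gs")
      (simp_all add: form_def X_pow_def lookup_single lookup_sum when_def in_keys_iff if_distrib cong: if_cong)
qed

section \<open>From cochains to forms\<close>

context log_canonical
begin

text \<open>The list enters because the weight of a coefficient depends on it. Keeping only resonant
  weights sends coboundaries to the zero form and, by \<open>cocycle_is_coboundary\<close>, kills no
  other cocycle.\<close>

definition resonant_part :: "'n list \<Rightarrow> 'n cpoly \<Rightarrow> 'n cpoly" where
  "resonant_part is f =
     Abs_poly_mapping (\<lambda>\<alpha>. if resonant A (weight is \<alpha>) then Poly_Mapping.lookup f \<alpha> else 0)"

lemma lookup_resonant_part [simp]:
  "Poly_Mapping.lookup (resonant_part is f) \<alpha> =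
     (if resonant A (weight is \<alpha>) then Poly_Mapping.lookup f \<alpha> else 0)"
  unfolding resonant_part_def
  by (subst lookup_Abs_poly_mapping) (auto intro: finite_subset[OF _ finite_lookup[of f]])

text \<open>Contraction with the volume form \<open>dX\<^sub>1 \<and> \<dots> \<and> dX\<^sub>n\<close>, up to signs, followed by
  the projection to the resonant weights.\<close>

definition form_of_cochain :: "nat \<Rightarrow> ('n cpoly list \<Rightarrow> 'n cpoly) \<Rightarrow> 'n cpoly free_form" where
  "form_of_cochain k P = (\<Sum>I | card I = k.
     form (resonant_part (increasing I) (P (map X (increasing I)))) (map X (increasing (- I))))"

lemma linear_form_of_cochain:
  "Vector_Spaces.linear (cochain_scale pscale) (form_scale pscale) (form_of_cochain k)"
  unfolding Vector_Spaces.linear_iff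
proof (intro conjI allI vector_space_cochain_scale vector_space_form_scale)
  have add: "form (resonant_part is (f + g)) fs = form (resonant_part is f) fs + form (resonant_part is g) fs"
    for "is" f g fs
    unfolding form_def single_add[symmetric]
    by (intro arg_cong[of _ _ "Poly_Mapping.single fs"] poly_mapping_eqI) (simp add: lookup_add)
  show "form_of_cochain k (P + Q) = form_of_cochain k P + form_of_cochain k Q" for P Q
    by (simp add: form_of_cochain_def add sum.distrib)
  interpret V: vector_space "form_scale (pscale :: complex \<Rightarrow> 'n cpoly \<Rightarrow> 'n cpoly)"
    by (rule vector_space_form_scale)
  have scale: "form (resonant_part is (pscale c f)) fs = form_scale pscale c (form (resonant_part is f) fs)"
    for "is" c f fs
    unfolding form_def
    by (intro poly_mapping_eqI) (auto simp: lookup_single when_def)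
  show "form_of_cochain k (cochain_scale pscale c P) = form_scale pscale c (form_of_cochain k P)" for c P
    by (simp add: form_of_cochain_def scale V.scale_sum_right cochain_scale_def)
qed

text \<open>The determinant \<open>?E\<close> is 1 on the variables outside \<open>I\<close> and 0
  on those outside any other set of the same size. Pairing with it isolates the summand of
  \<open>I\<close>, while relations pair to zero.\<close>

lemma form_of_cochain_relations:
  assumes rel: "form_of_cochain k P \<in> form_relations pscale" and I: "card I = k"
  shows "resonant_part (increasing I) (P (map X (increasing I))) = 0"
proof -
  let ?js = "increasing (- I)"
  let ?E = "cochain_of (length ?js) (alternating_indicator ?js)"
  let ?r = "\<lambda>I. resonant_part (increasing I) (P (map X (increasing I)))"
  have E: "?E \<in> cochains pscale (length ?js)"
    by (rule cochain_of_in_cochains[OF skew_alternating_indicator])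
  have val: "?E (map X (increasing (- I'))) = (if I = I' then 1 else 0)" if cI': "card I' = k" for I'
  proof -
    have "length (increasing (- I')) = length ?js"
      using cI' I card_Compl_add[of I] card_Compl_add[of I'] by simp
    then have "?E (map X (increasing (- I'))) = alternating_indicator ?js (increasing (- I'))"
      by (rule cochain_of_variables)
    moreover have "alternating_indicator ?js (increasing (- I')) = 0" if "I \<noteq> I'"
    proof (rule ccontr)
      assume "alternating_indicator ?js (increasing (- I')) \<noteq> 0"
      then have "set (increasing (- I')) = - I"
        by (simp only: alternating_indicator_nonzero mset_increasing_eq_iff[symmetric] distinct_sorted_list_of_set)
      with that show False by simp
    qed
    ultimately show ?thesis
      by (auto simp: alternating_indicator_self)
  qed
  have "form_pairing ?E (sum F S) = (\<Sum>i\<in>S. form_pairing ?E (F i))" for F and S :: "'n set set"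
    by (induction S rule: infinite_finite_induct) (auto simp: form_pairing_add, simp_all add: form_pairing_def)
  then have "form_pairing ?E (form_of_cochain k P) =
      (\<Sum>I' | card I' = k. ?r I' * ?E (map X (increasing (- I'))))"
    by (simp only: form_of_cochain_def form_pairing_form)
  also have "\<dots> = (\<Sum>I' | card I' = k. if I = I' then ?r I' else 0)"
    by (rule sum.cong[OF refl]) (simp only: mem_Collect_eq val mult_1_right mult_zero_right split: if_split, simp)
  also have "\<dots> = ?r I"
    using I by simp
  finally show ?thesis
    using form_pairing_relations[OF E rel] by simp
qed

lemma form_of_cochain_coboundaries:
  assumes "P \<in> coboundaries pscale br k"
  shows "form_of_cochain k P = 0"
proof -
  have "resonant_part (increasing I) (P (map X (increasing I))) = 0" if "card I = k" for I
    by (rule poly_mapping_eqI) (use lookup_coboundaries_resonant[OF assms] that in auto)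
  then show ?thesis
    by (simp add: form_of_cochain_def form_def)
qed

text \<open>This gives injectivity on cohomology. The resonant coefficients vanish on increasing
  lists, hence on all distinct lists by skew symmetry, and lists with repetitions give zero
  anyway.\<close>

lemma coboundary_of_form_relations:
  assumes P: "P \<in> cocycles pscale br k" and rel: "form_of_cochain k P \<in> form_relations pscale"
  shows "P \<in> coboundaries pscale br k"
proof (rule cocycle_is_coboundary[OF P])
  fix "is" \<alpha>
  assume len: "length is = k" and res: "resonant A (weight is \<alpha>)"
  have Pc: "P \<in> cochains pscale k" using P by (simp add: cocycles_def)
  show "Poly_Mapping.lookup (P (map X is)) \<alpha> = 0"
  proof (cases "distinct is")
    case True
    let ?js = "increasing (set is)"
    have perm: "mset is = mset ?js"
      using True by (simp add: mset_increasing_eq_iff)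
    then have "weight ?js = weight is"
      by (simp add: weight_def count_mset[symmetric] fun_eq_iff)
    moreover have "card (set is) = k" using True len distinct_card by blast
    ultimately have "Poly_Mapping.lookup (P (map X ?js)) \<alpha> = 0"
      using form_of_cochain_relations[OF rel, of "set is"] res
      by (metis lookup_resonant_part lookup_zero)
    moreover have "P (map X is) = P (map X ?js) \<or> P (map X is) = - P (map X ?js)"
      using cochain_permute[OF Pc, of "map X is" "map X ?js" "[]"] perm by simp
    ultimately show ?thesis by auto
  next
    case False
    then have "\<not> distinct (map X is :: 'n cpoly list)"
      by (simp add: distinct_map)
    then show ?thesis by (simp add: cochain_not_distinct[OF Pc])
  qed
qed

definition complement_exp :: "'n set \<Rightarrow> 'n \<Rightarrow>\<^sub>0 nat" where
  "complement_exp I = Abs_poly_mapping (\<lambda>i. if i \<in> I then 0 else 1)"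

lemma lookup_complement_exp [simp]:
  "Poly_Mapping.lookup (complement_exp I) i = (if i \<in> I then 0 else 1)"
  by (simp add: complement_exp_def)

text \<open>With \<open>\<gamma> = \<alpha> + complement_exp I\<close> the weight is
  \<open>\<gamma>\<close> minus 1 in each coordinate. A negative weight therefore means
  \<open>\<gamma>\<close> is zero there, and the residue is the sum in
  \<open>index_set_C\<close>.\<close>

lemma resonant_iff_index_set_C:
  "resonant A (weight (increasing I) \<alpha>) \<longleftrightarrow> \<alpha> + complement_exp I \<in> index_set_C A"
proof -
  have "count_list (increasing I) i = (if i \<in> I then 1 else 0)" for i
    using distinct_count_atmost_1[of "increasing I"] by (simp add: count_mset)
  then have "weight (increasing I) \<alpha> i = int (Poly_Mapping.lookup (\<alpha> + complement_exp I) i) - 1" for i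
    by (simp add: weight_def lookup_add)
  then show ?thesis
    by (auto simp: resonant_def residue_def index_set_C_def)
qed

lemma monomial_form_complement_exp:
  "monomial_form \<alpha> (complement_exp I) = form (X_pow \<alpha>) (map X (increasing (- I)))"
proof -
  have "{i. Poly_Mapping.lookup (complement_exp I) i = 1} = - I" by auto
  then show ?thesis by (simp add: monomial_form_def)
qed

lemma form_basis_eq:
  "form_basis A k = {form (X_pow \<alpha>) (map X (increasing (- I))) | \<alpha> I.
     card I = k \<and> resonant A (weight (increasing I) \<alpha>)}"
proof -
  have sum: "(\<Sum>i\<in>UNIV. Poly_Mapping.lookup (complement_exp I) i) + k = CARD('n) \<longleftrightarrow> card I = k" for I :: "'n set"
  proof -
    have "(\<Sum>i\<in>UNIV. Poly_Mapping.lookup (complement_exp I) i) = card (- I)"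
      by (simp add: sum.If_cases)
    then show ?thesis
      using card_Compl_add[of I] by auto
  qed
  have "\<exists>I. \<beta> = complement_exp I" if "\<forall>i. Poly_Mapping.lookup \<beta> i \<in> {0, 1}" for \<beta> :: "'n \<Rightarrow>\<^sub>0 nat"
    using that by (intro exI[of _ "{i. Poly_Mapping.lookup \<beta> i = 0}"] poly_mapping_eqI)
      (auto, metis not_gr_zero)
  then have "form_basis A k = {monomial_form \<alpha> (complement_exp I) | \<alpha> I.
     (\<Sum>i\<in>UNIV. Poly_Mapping.lookup (complement_exp I) i) + k = CARD('n) \<and>
     \<alpha> + complement_exp I \<in> index_set_C A}"
    unfolding form_basis_def by (fastforce intro: exI)
  then show ?thesis
    by (simp only: sum monomial_form_complement_exp resonant_iff_index_set_C)
qed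

text \<open>The projection \<open>resonant_part\<close> puts the form of any cochain into the span.
  Conversely, a monomial form comes from X^alpha d/dX_I, which is a cocycle because its only weight
  is resonant.\<close>

lemma form_of_cochain_image:
  "form_of_cochain k ` cocycles pscale br k = module.span (form_scale pscale) (form_basis A k)"
proof
  interpret L: Vector_Spaces.linear "cochain_scale pscale" "form_scale pscale" "form_of_cochain k"
    by (rule linear_form_of_cochain)
  show "form_of_cochain k ` cocycles pscale br k \<subseteq> L.vs2.span (form_basis A k)"
  proof (rule image_subsetI)
    fix P
    have "form (resonant_part (increasing I) f) (map X (increasing (- I))) \<in> L.vs2.span (form_basis A k)"
      if "card I = k" for I f
    proof -
      let ?r = "resonant_part (increasing I) f" and ?js = "map X (increasing (- I))"
      have "form (X_pow \<alpha>) ?js \<in> form_basis A k" if "\<alpha> \<in> Poly_Mapping.keys ?r" for \<alpha>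
        using that \<open>card I = k\<close> by (auto simp: form_basis_eq in_keys_iff split: if_splits)
      then show ?thesis
        unfolding form_eq_sum_monomials[of ?r] by (intro L.vs2.span_sum L.vs2.span_scale L.vs2.span_base)
    qed
    then show "form_of_cochain k P \<in> L.vs2.span (form_basis A k)"
      unfolding form_of_cochain_def by (intro L.vs2.span_sum) auto
  qed
  show "L.vs2.span (form_basis A k) \<subseteq> form_of_cochain k ` cocycles pscale br k"
  proof (rule L.vs2.span_minimal)
    show "L.vs2.subspace (form_of_cochain k ` cocycles pscale br k)"
      by (rule L.subspace_image[OF subspace_cocycles])
    show "form_basis A k \<subseteq> form_of_cochain k ` cocycles pscale br k"
    proof
      fix F assume "F \<in> form_basis A k"
      then obtain \<alpha> I where F: "F = form (X_pow \<alpha>) (map X (increasing (- I)))" and I: "card I = k"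
        and res: "resonant A (weight (increasing I) \<alpha>)"
        by (auto simp: form_basis_eq)
      define q where "q is = X_pow \<alpha> * alternating_indicator (increasing I) is" for "is"
      define P where "P = cochain_of k q"
      have "skew_on_lists k q"
        using skew_alternating_indicator[of "increasing I"] I by (simp add: skew_on_lists_def q_def)
      then have Pc: "P \<in> cochains pscale k"
        unfolding P_def by (rule cochain_of_in_cochains)
      have P: "P (map X is) = q is" if "length is = k" for "is"
        unfolding P_def using that by (rule cochain_of_variables)
      have "resonant A (weight is \<alpha>')"
        if len: "length is = k" and nz: "Poly_Mapping.lookup (P (map X is)) \<alpha>' \<noteq> 0" for "is" \<alpha>'
      proof -
        have "alternating_indicator (increasing I) is \<noteq> 0"
          using nz P[OF len] by (auto simp: q_def)
        then have "mset is = mset (increasing I)"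
          by (rule alternating_indicator_nonzero)
        then have "weight is = weight (increasing I)"
          by (simp add: weight_def count_mset[symmetric] fun_eq_iff)
        moreover have "\<alpha>' = \<alpha>"
        proof -
          \<comment> \<open>Being a sum of signs, the indicator is an integer constant, so
            multiplying by it introduces no exponent other than \<open>\<alpha>\<close>.\<close>
          have "\<exists>z :: int. alternating_indicator (increasing I) is = of_int z"
          proof -
            have "alternating_indicator (increasing I) is = of_int (\<Sum>p | p permutes {..<length (increasing I)}.
              sign p * (if is = permute_list p (increasing I) then 1 else 0))"
              unfolding alternating_indicator_def of_int_sum by (intro sum.cong) auto
            then show ?thesis by blast
          qed
          then obtain z :: int where "P (map X is) = of_int z * X_pow \<alpha>"
            using P[OF len] by (auto simp: q_def mult.commute)
          then show ?thesis
            using nz by (auto simp: X_pow_def lookup_single when_def split: if_splits)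
        qed
        ultimately show ?thesis using res by simp
      qed
      then have "P \<in> cocycles pscale br k"
        using coboundary_of_resonant[OF Pc] Pc by (simp add: cocycles_def)
      moreover have "form_of_cochain k P = F"
      proof -
        have "form (resonant_part (increasing I') (P (map X (increasing I')))) (map X (increasing (- I')))
          = (if I = I' then F else 0)" if "card I' = k" for I'
        proof -
          have "resonant_part (increasing I) (X_pow \<alpha>) = X_pow \<alpha>"
            by (rule poly_mapping_eqI) (use res in \<open>auto simp: X_pow_def lookup_single when_def\<close>)
          moreover have "alternating_indicator (increasing I) (increasing I') = 0" if "I \<noteq> I'"
            using alternating_indicator_nonzero[of "increasing I" "increasing I'"] that
              mset_increasing_eq_iff[of "increasing I'" I] by auto
          moreover have "resonant_part js 0 = 0" for js
            by (rule poly_mapping_eqI) simp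
          ultimately show ?thesis
            using that by (auto simp: P q_def F alternating_indicator_self form_def)
        qed
        then show ?thesis
          using I by (simp add: form_of_cochain_def)
      qed
      ultimately show "F \<in> form_of_cochain k ` cocycles pscale br k" by blast
    qed
  qed
qed

end

theorem corollary3p5p2:
  fixes A :: "int ^ 'n::{finite,linorder} ^ 'n::{finite,linorder}"
    and br :: "'n cpoly \<Rightarrow> 'n cpoly \<Rightarrow> 'n cpoly"
    and k :: nat
  assumes "transpose A = - A"
    and "poisson_algebra pscale br"
    and "\<And>i j. br (X i) (X j) = of_int (A $ i $ j) * X i * X j"
  shows "quotient_isomorphic
           (cochain_scale pscale) (cocycles pscale br k) (coboundaries pscale br k)
           (form_scale pscale) (module.span (form_scale pscale) (form_basis A k))
           (form_relations pscale)"
proof -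
  interpret poisson_algebra pscale br by fact
  interpret log_canonical br A
    by unfold_locales (fact assms)+
  show ?thesis
    unfolding form_of_cochain_image[symmetric]
  proof (rule quotient_isomorphicI[OF linear_form_of_cochain subspace_cocycles subspace_coboundaries
        subspace_form_relations])
    interpret V: vector_space "form_scale (pscale :: complex \<Rightarrow> 'n cpoly \<Rightarrow> 'n cpoly)"
      by (rule vector_space_form_scale)
    show "form_of_cochain k P \<in> form_relations pscale" if "P \<in> coboundaries pscale br k" for P
      using form_of_cochain_coboundaries[OF that] V.subspace_0[OF subspace_form_relations] by simp
  qed (rule coboundary_of_form_relations)
qed

end
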